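(* Let $G$ be a finitely generated abelian group and $\phi:G\to G$ an endomorphism with $R(\phi^n)<\infty$ for all $n\ge1$. With $k$, $\phi^\infty$, $A$, $p$, $r$ as below and $\sigma=(-1)^p$, the Reidemeister zeta function $R_\phi(z)$ is a rational function and $$R_\phi(z)=\Big(\prod_{i=0}^{k}\det\big(1-\Lambda^i\phi^\infty\otimes A\cdot\sigma z\big)^{(-1)^{i+1}}\Big)^{(-1)^r}.$$
   Context: $R(\psi)$ is the number of $\psi$-conjugacy classes ($\alpha\sim\gamma\alpha\psi(\gamma)^{-1}$), and $R_\phi(z)=\exp\big(\sum_{n\ge1}R(\phi^n)z^n/n\big)$. $\mathrm{Tors}\,G$ is the torsion subgroup, $G^\infty=G/\mathrm{Tors}\,G\cong\mathbb{Z}^k$, $\phi^{tor}$ and $\phi^\infty$ the induced endomorphisms of $\mathrm{Tors}\,G$ and $G^\infty$; $A$ is the linear map $h\mapsto h\circ\phi^{tor}$ on complex-valued functions on $\mathrm{Tors}\,G$; $p$ is the number of eigenvalues $\mu<-1$ of $\phi^\infty$ and $r$ the number of real eigenvalues of $\phi^\infty$ with $|\mu|>1$; $\Lambda^i$ is exterior power over $\mathbb{C}$. *)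

theory Defs
  imports "Jordan_Normal_Form.Char_Poly" "Jordan_Normal_Form.DL_Submatrix"
    "HOL-Computational_Algebra.Polynomial_FPS"
begin

fun nmul :: "nat \<Rightarrow> 'g::ab_group_add \<Rightarrow> 'g" where
  "nmul 0 x = 0"
| "nmul (Suc n) x = x + nmul n x"

definition zmul :: "int \<Rightarrow> 'g::ab_group_add \<Rightarrow> 'g" where
  "zmul c x = (if c \<ge> 0 then nmul (nat c) x else - nmul (nat (- c)) x)"

definition lincomb :: "int list \<Rightarrow> 'g::ab_group_add list \<Rightarrow> 'g" where
  "lincomb cs bs = (\<Sum>j<length bs. zmul (cs ! j) (bs ! j))"

definition fin_gen_group :: "'g::ab_group_add itself \<Rightarrow> bool" where
  "fin_gen_group _ \<longleftrightarrow> (\<exists>gs :: 'g list. \<forall>x. \<exists>cs. length cs = length gs \<and> x = lincomb cs gs)"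

definition group_endo :: "('g::ab_group_add \<Rightarrow> 'g) \<Rightarrow> bool" where
  "group_endo f \<longleftrightarrow> (\<forall>x y. f (x + y) = f x + f y)"

definition reid_rel :: "('g::ab_group_add \<Rightarrow> 'g) \<Rightarrow> ('g \<times> 'g) set" where
  "reid_rel psi = {(a, b). \<exists>g. b = g + a - psi g}"

definition reid_classes :: "('g::ab_group_add \<Rightarrow> 'g) \<Rightarrow> 'g set set" where
  "reid_classes psi = UNIV // reid_rel psi"

definition reid_num :: "('g::ab_group_add \<Rightarrow> 'g) \<Rightarrow> nat" where
  "reid_num psi = card (reid_classes psi)"

definition reid_zeta :: "('g::ab_group_add \<Rightarrow> 'g) \<Rightarrow> complex fps" where
  "reid_zeta phi = fps_exp 1 oo
     Abs_fps (\<lambda>n. if n = 0 then 0 else of_nat (reid_num (phi ^^ n)) / of_nat n)"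

definition torsion :: "'g::ab_group_add set" where
  "torsion = {x. \<exists>n>0. nmul n x = 0}"

(* bs is a basis of G/Tors G: every x is uniquely an integer combination of bs modulo torsion *)
definition inf_basis_of :: "'g::ab_group_add list \<Rightarrow> bool" where
  "inf_basis_of bs \<longleftrightarrow> (\<forall>x. \<exists>!cs. length cs = length bs \<and> x - lincomb cs bs \<in> torsion)"

definition inf_basis :: "'g::ab_group_add itself \<Rightarrow> 'g list" where
  "inf_basis _ = (SOME bs. inf_basis_of bs)"

definition rank_inf :: "'g::ab_group_add itself \<Rightarrow> nat" where
  "rank_inf T = length (inf_basis T)"

definition phi_inf_mat :: "('g::ab_group_add \<Rightarrow> 'g) \<Rightarrow> complex mat" where
  "phi_inf_mat phi = (let bs = inf_basis TYPE('g); k = length bs in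
     mat k k (\<lambda>(i, j). of_int ((THE cs. length cs = k \<and> phi (bs ! j) - lincomb cs bs \<in> torsion) ! i)))"

definition tors_list :: "'g::ab_group_add itself \<Rightarrow> 'g list" where
  "tors_list _ = (SOME xs. distinct xs \<and> set xs = torsion)"

(* matrix of A : h \<mapsto> h \<circ> phi^tor on functions Tors G \<rightarrow> C, in the basis of indicator
   functions delta_t (t in Tors G):  (A delta_b)(a) = [phi a = b] *)
definition A_mat :: "('g::ab_group_add \<Rightarrow> 'g) \<Rightarrow> complex mat" where
  "A_mat phi = (let ts = tors_list TYPE('g); m = length ts in
     mat m m (\<lambda>(a, b). if phi (ts ! a) = ts ! b then 1 else 0))"

definition subsets_of_size :: "nat \<Rightarrow> nat \<Rightarrow> nat list list" where
  "subsets_of_size n i = filter (\<lambda>xs. length xs = i) (subseqs [0..<n])"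

(* matrix of Lambda^i M on Lambda^i C^n w.r.t. the basis e_I (I an i-subset):
   the i-th compound matrix *)
definition ext_pow_mat :: "nat \<Rightarrow> complex mat \<Rightarrow> complex mat" where
  "ext_pow_mat i M = (let S = subsets_of_size (dim_row M) i in
     mat (length S) (length S) (\<lambda>(a, b). det (submatrix M (set (S ! a)) (set (S ! b)))))"

definition kron :: "complex mat \<Rightarrow> complex mat \<Rightarrow> complex mat" where
  "kron M N = (let n = dim_row N in
     mat (dim_row M * n) (dim_col M * dim_col N)
       (\<lambda>(a, b). M $$ (a div n, b div dim_col N) * N $$ (a mod n, b mod dim_col N)))"

definition det_one_minus :: "complex mat \<Rightarrow> complex \<Rightarrow> complex poly" where
  "det_one_minus M c = det (mat (dim_row M) (dim_row M)
      (\<lambda>(a, b). (if a = b then 1 else 0) - [:0, c * M $$ (a, b):]))"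

definition num_eigs :: "complex mat \<Rightarrow> (complex \<Rightarrow> bool) \<Rightarrow> nat" where
  "num_eigs M P = (\<Sum>\<mu>\<in>{\<mu>. poly (char_poly M) \<mu> = 0 \<and> P \<mu>}. order \<mu> (char_poly M))"

definition fps_pm :: "bool \<Rightarrow> complex fps \<Rightarrow> complex fps" where
  "fps_pm pos f = (if pos then f else inverse f)"

end

theory Submission
  imports Defs "Jordan_Normal_Form.Schur_Decomposition" "HOL-Library.Function_Algebras"
begin

text \<open>For an endomorphism \<open>\<psi>\<close> of an abelian group, \<open>R(\<psi>)\<close> is the index of the image of
  \<open>1 - \<psi>\<close>. Splitting \<open>G\<close> along the coordinate map modulo torsion gives
  \<open>R(\<phi>\<^sup>n) = \<bar>det (1 - \<Phi>\<^sup>n)\<bar> * #Fix (\<phi>\<^sup>n on Tors G)\<close>: the free part contributes the index of an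
  integer lattice, and on the finite torsion part the cokernel of \<open>1 - \<phi>\<^sup>n\<close> is as large as its
  kernel. The fixed points are counted by \<open>tr (A\<^sup>n)\<close>. As the eigenvalues of \<open>\<Phi>\<close> come in
  conjugate pairs, only real ones influence the sign of the determinant, which is
  \<open>(-1)\<^bsup>r + pn\<^esup>\<close>; and \<open>det (1 - \<Phi>\<^sup>n)\<close> is the alternating sum of the traces of
  \<open>(\<Lambda>\<^sup>i \<Phi>)\<^sup>n\<close> (Cauchy-Binet makes \<open>\<Lambda>\<^sup>i\<close> multiplicative). So \<open>R(\<phi>\<^sup>n)\<close> is a signed sum
  of traces of \<open>n\<close>-th powers, and \<open>exp (\<Sum> tr (B\<^sup>n) z\<^sup>n / n) = 1 / det (1 - B z)\<close>.\<close>

section \<open>The Cauchy-Binet formula\<close>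

text \<open>No complement of Tors G is chosen to count classes. For a homomorphism c the index
  [A : H] is the index of cH in cA times the index of the kernel of c on H in the kernel of c on A;
  c is the coordinate map, with kernel Tors G. With H the image of 1 - phi^n this leaves the part of
  H inside Tors G, which a priori exceeds the image of Tors G. Finiteness of the classes removes the
  obstacle: \<open>card\<close> records an infinite index as 0, so a positive class number forces
  det (1 - Phi^n) to be nonzero, and then only torsion elements are mapped into Tors G. Each sign of
  the final formula has its own source. The factor (-1)^r does not depend on n and becomes the outer
  exponent; (-1)^(pn) is sigma^n and rescales z; (-1)^i comes from expanding det (1 - Phi^n), and
  since the exponential of a trace series is the inverse of a determinant, the inner exponent is
  (-1)^(i+1). The tensor product appears because the product of two traces is the trace of a
  Kronecker product.\<close>

lemma bij_betw_pick:
  assumes "finite K" "card K = m"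
  shows "bij_betw (pick K) {0..<m} K"
proof -
  have inj: "inj_on (pick K) {0..<m}"
  proof (rule inj_onI)
    fix x y assume "x \<in> {0..<m}" "y \<in> {0..<m}" "pick K x = pick K y"
    then show "x = y"
      using pick_mono_le[of x K y] pick_mono_le[of y K x] assms
      by (metis atLeastLessThan_iff less_irrefl linorder_neqE_nat)
  qed
  moreover have "pick K ` {0..<m} \<subseteq> K"
    using pick_in_set_le assms by auto
  ultimately have "pick K ` {0..<m} = K"
    using assms by (metis card_image card_subset_eq card_atLeastLessThan diff_zero)
  with inj show ?thesis by (simp add: bij_betw_def)
qed

text \<open>An injective map amounts to its image K together with the order in which K is traversed.
  This regroups the injective terms of the Leibniz expansion in \<open>Cauchy_Binet\<close> by
  K.\<close>

lemma bij_betw_pick_permutes: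
  "bij_betw (\<lambda>(K, t). restrict (pick K \<circ> t) {0..<m})
     ({K. K \<subseteq> {0..<n} \<and> card K = m} \<times> {t. t permutes {0..<m}})
     {f \<in> {0..<m} \<rightarrow>\<^sub>E {0..<n}. inj_on f {0..<m}}"
  (is "bij_betw ?g (?S \<times> ?P) ?T")
proof -
  have bp: "bij_betw (pick K) {0..<m} K" if "K \<in> ?S" for K
    using that by (intro bij_betw_pick) (auto intro: finite_subset)
  have bc: "bij_betw (pick K \<circ> t) {0..<m} K" if "K \<in> ?S" "t \<in> ?P" for K t
    using that(2) by (intro bij_betw_trans[OF permutes_imp_bij bp[OF that(1)]]) simp
  have br: "bij_betw (?g (K, t)) {0..<m} K" if "K \<in> ?S" "t \<in> ?P" for K t
    using bc[OF that] by (simp add: bij_betw_restrict_eq del: comp_apply)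
  have "inj_on ?g (?S \<times> ?P)"
  proof (rule inj_onI)
    fix x y assume x: "x \<in> ?S \<times> ?P" and y: "y \<in> ?S \<times> ?P" and eq: "?g x = ?g y"
    obtain K s where xK: "x = (K, s)" "K \<in> ?S" "s \<in> ?P" using x by auto
    obtain L t where yL: "y = (L, t)" "L \<in> ?S" "t \<in> ?P" using y by auto
    have "?g x ` {0..<m} = K"
      unfolding xK(1) by (rule bij_betw_imp_surj_on[OF br[OF xK(2,3)]])
    moreover have "?g y ` {0..<m} = L"
      unfolding yL(1) by (rule bij_betw_imp_surj_on[OF br[OF yL(2,3)]])
    ultimately have KL: "K = L" unfolding eq by simp
    have "s i = t i" for i
    proof (cases "i \<in> {0..<m}")
      case True
      then have "pick K (s i) = pick K (t i)"
        using fun_cong[OF eq[unfolded xK(1) yL(1)], of i] KL by simp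
      moreover have "s i \<in> {0..<m}" "t i \<in> {0..<m}"
        using True xK(3) yL(3) by (simp_all add: permutes_in_image[of _ "{0..<m}"] del: atLeastLessThan_iff)
      ultimately show ?thesis 
        using inj_onD[OF bij_betw_imp_inj_on[OF bp[OF xK(2)]]] by blast
    next
      case False
      then show ?thesis using xK(3) yL(3) by (simp add: permutes_def)
    qed
    then show "x = y" using xK(1) yL(1) KL by auto
  qed
  moreover have "?g ` (?S \<times> ?P) = ?T"
  proof (intro equalityI subsetI)
    fix f assume "f \<in> ?g ` (?S \<times> ?P)"
    then obtain K t where K: "K \<in> ?S" "t \<in> ?P" "f = ?g (K, t)" by auto
    then have b: "bij_betw f {0..<m} K" using br by simp
    have "f \<in> extensional {0..<m}" using K(3) by simp
    moreover have "f \<in> {0..<m} \<rightarrow> {0..<n}" using bij_betw_imp_surj_on[OF b] K(1) by blast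
    moreover have "inj_on f {0..<m}" using b by (rule bij_betw_imp_inj_on)
    ultimately show "f \<in> ?T" by (simp add: PiE_def)
  next
    fix f assume f: "f \<in> ?T"
    define K where "K = f ` {0..<m}"
    have bf: "bij_betw f {0..<m} K" using f by (simp add: K_def bij_betw_def)
    have K: "K \<in> ?S" using f by (auto simp: K_def card_image)
    \<comment> \<open>Pulls f back along the increasing enumeration of its image; the value i
      outside the range is what \<open>permutes\<close> demands.\<close>
    define t where "t = (\<lambda>i. if i \<in> {0..<m} then inv_into {0..<m} (pick K) (f i) else i)"
    have "bij_betw (inv_into {0..<m} (pick K) \<circ> f) {0..<m} {0..<m}"
      by (rule bij_betw_trans[OF bf bij_betw_inv_into[OF bp[OF K]]])
    then have "bij_betw t {0..<m} {0..<m}"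
      by (rule bij_betw_cong[THEN iffD1, rotated]) (simp add: t_def)
    then have t: "t \<in> ?P" by (auto intro: bij_imp_permutes simp: t_def)
    have "f = ?g (K, t)"
    proof
      fix i show "f i = ?g (K, t) i"
      proof (cases "i \<in> {0..<m}")
        case True
        then have "f i \<in> pick K ` {0..<m}"
          unfolding bij_betw_imp_surj_on[OF bp[OF K]] by (simp add: K_def)
        then show ?thesis using True by (simp add: t_def f_inv_into_f)
      next
        case False
        then show ?thesis using f by (auto simp: PiE_def extensional_def)
      qed
    qed
    then show "f \<in> ?g ` (?S \<times> ?P)" using K t by blast
  qed
  ultimately show ?thesis by (simp add: bij_betw_def)
qed

text \<open>Multiplying out the Leibniz formula for the product gives a sum over all maps f choosing
  an inner index for each row. A non-injective f repeats a row of Y and contributes 0; the injective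
  ones with image K combine to a product of two minors.\<close>

theorem Cauchy_Binet:
  fixes X Y :: "'a::comm_ring_1 mat"
  assumes X: "X \<in> carrier_mat m n" and Y: "Y \<in> carrier_mat n m"
  shows "det (X * Y) = (\<Sum>K | K \<subseteq> {0..<n} \<and> card K = m.
     det (mat m m (\<lambda>(i, j). X $$ (i, pick K j))) * det (mat m m (\<lambda>(i, j). Y $$ (pick K i, j))))"
proof -
  let ?P = "{t. t permutes {0..<m}}"
  let ?F = "{0..<m} \<rightarrow>\<^sub>E {0..<n}"
  let ?S = "{K. K \<subseteq> {0..<n} \<and> card K = m}"
  let ?Y = "\<lambda>f. mat m m (\<lambda>(i, j). Y $$ (f i, j))"
  let ?h = "\<lambda>f. (\<Prod>i=0..<m. X $$ (i, f i)) * det (?Y f)"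
  have fin: "finite ?F" by (intro finite_PiE) auto
  have "det (X * Y) = (\<Sum>s\<in>?P. signof s * (\<Prod>i=0..<m. (X * Y) $$ (i, s i)))"
    using X Y by (intro det_def') auto
  also have "\<dots> = (\<Sum>s\<in>?P. signof s * (\<Prod>i=0..<m. \<Sum>k=0..<n. X $$ (i, k) * Y $$ (k, s i)))"
  proof (intro sum.cong refl arg_cong2[where f = "(*)"] prod.cong)
    fix s i assume "s \<in> ?P" "i \<in> {0..<m}"
    then have "s i < m" "i < m" using permutes_in_image[of s "{0..<m}" i] by auto
    then show "(X * Y) $$ (i, s i) = (\<Sum>k=0..<n. X $$ (i, k) * Y $$ (k, s i))"
      using X Y by (auto simp: scalar_prod_def intro!: sum.cong)
  qed
  also have "\<dots> = (\<Sum>s\<in>?P. signof s * (\<Sum>f\<in>?F. \<Prod>i=0..<m. X $$ (i, f i) * Y $$ (f i, s i)))"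
    by (subst prod_sum_PiE) auto
  also have "\<dots> = (\<Sum>f\<in>?F. \<Sum>s\<in>?P. signof s * (\<Prod>i=0..<m. X $$ (i, f i) * Y $$ (f i, s i)))"
    unfolding sum_distrib_left by (rule sum.swap)
  also have "\<dots> = (\<Sum>f\<in>?F. ?h f)"
  proof (intro sum.cong refl)
    fix f assume "f \<in> ?F"
    have "det (?Y f) = (\<Sum>s\<in>?P. signof s * (\<Prod>i=0..<m. ?Y f $$ (i, s i)))"
      by (rule det_def') simp
    also have "\<dots> = (\<Sum>s\<in>?P. signof s * (\<Prod>i=0..<m. Y $$ (f i, s i)))"
    proof (intro sum.cong refl arg_cong2[where f = "(*)"] prod.cong)
      fix s i assume "s \<in> ?P" "i \<in> {0..<m}"
      then have "s i < m" "i < m" using permutes_in_image[of s "{0..<m}" i] by auto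
      then show "?Y f $$ (i, s i) = Y $$ (f i, s i)" by simp
    qed
    finally show "(\<Sum>s\<in>?P. signof s * (\<Prod>i=0..<m. X $$ (i, f i) * Y $$ (f i, s i))) = ?h f"
      by (simp add: sum_distrib_left prod.distrib mult_ac)
  qed
  also have "\<dots> = (\<Sum>f\<in>{f \<in> ?F. inj_on f {0..<m}}. ?h f)"
  proof (rule sum.mono_neutral_right[OF fin])
    show "\<forall>f\<in>?F - {f \<in> ?F. inj_on f {0..<m}}. ?h f = 0"
    proof
      fix f assume "f \<in> ?F - {f \<in> ?F. inj_on f {0..<m}}"
      then obtain i j where ij: "i < m" "j < m" "i \<noteq> j" "f i = f j" by (auto simp: inj_on_def)
      have "det (?Y f) = 0"
        by (rule det_identical_rows[of _ m i j]) (use ij in \<open>auto intro!: eq_vecI\<close>)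
      then show "?h f = 0" by simp
    qed
  qed auto
  also have "\<dots> = (\<Sum>x\<in>?S \<times> ?P. ?h ((\<lambda>(K, t). restrict (pick K \<circ> t) {0..<m}) x))"
    by (rule sum.reindex_bij_betw[OF bij_betw_pick_permutes, symmetric])
  also have "\<dots> = (\<Sum>K\<in>?S. \<Sum>t\<in>?P. ?h (restrict (pick K \<circ> t) {0..<m}))"
    by (simp add: sum.cartesian_product case_prod_unfold)
  also have "\<dots> = (\<Sum>K\<in>?S. det (mat m m (\<lambda>(i, j). X $$ (i, pick K j))) *
                           det (mat m m (\<lambda>(i, j). Y $$ (pick K i, j))))"
  proof (intro sum.cong refl)
    fix K assume "K \<in> ?S"
    let ?YK = "mat m m (\<lambda>(i, j). Y $$ (pick K i, j))"
    let ?XK = "mat m m (\<lambda>(i, j). X $$ (i, pick K j))"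
    \<comment> \<open>Sorting the rows of the Y-minor costs the sign of t, and this sign turns the
      remaining X-products into the Leibniz expansion of the X-minor.\<close>
    have "?h (restrict (pick K \<circ> t) {0..<m}) = (signof t * (\<Prod>i=0..<m. ?XK $$ (i, t i))) * det ?YK"
      if t: "t \<in> ?P" for t
    proof -
      have tm: "t i < m" if "i < m" for i
        using t permutes_in_image[of t "{0..<m}" i] that by auto
      have "?Y (restrict (pick K \<circ> t) {0..<m}) = mat m m (\<lambda>(i, j). ?YK $$ (t i, j))"
        by (rule eq_matI) (use tm in auto)
      also have "det \<dots> = signof t * det ?YK"
        by (rule det_permute_rows) (use t in auto)
      finally show ?thesis using tm by simp
    qed
    then have "(\<Sum>t\<in>?P. ?h (restrict (pick K \<circ> t) {0..<m}))
        = (\<Sum>t\<in>?P. signof t * (\<Prod>i=0..<m. ?XK $$ (i, t i))) * det ?YK"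
      by (simp add: sum_distrib_right del: restrict_apply)
    also have "(\<Sum>t\<in>?P. signof t * (\<Prod>i=0..<m. ?XK $$ (i, t i))) = det ?XK"
      by (rule det_def'[symmetric]) simp
    finally show "(\<Sum>t\<in>?P. ?h (restrict (pick K \<circ> t) {0..<m})) = det ?XK * det ?YK" .
  qed
  finally show ?thesis .
qed

section \<open>Traces and triangular matrices\<close>

definition mtrace :: "'a::comm_ring_1 mat \<Rightarrow> 'a" where
  "mtrace M = (\<Sum>i<dim_row M. M $$ (i, i))"

lemma mtrace_mult_comm:
  assumes "A \<in> carrier_mat n m" "B \<in> carrier_mat m n"
  shows "mtrace (A * B) = mtrace (B * A)"
proof -
  have "mtrace (A * B) = (\<Sum>i<n. \<Sum>k<m. A $$ (i, k) * B $$ (k, i))"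
    using assms by (auto simp: mtrace_def scalar_prod_def atLeast0LessThan intro!: sum.cong)
  also have "\<dots> = (\<Sum>k<m. \<Sum>i<n. B $$ (k, i) * A $$ (i, k))"
    by (subst sum.swap) (simp add: mult.commute)
  also have "\<dots> = mtrace (B * A)"
    using assms by (auto simp: mtrace_def scalar_prod_def atLeast0LessThan intro!: sum.cong)
  finally show ?thesis .
qed

lemma mtrace_conj:
  assumes "P \<in> carrier_mat n n" "B \<in> carrier_mat n n" "Q \<in> carrier_mat n n" "Q * P = 1\<^sub>m n"
  shows "mtrace (P * B * Q) = mtrace B"
proof -
  have "mtrace (P * B * Q) = mtrace (Q * (P * B))"
    using assms by (intro mtrace_mult_comm) auto
  also have "Q * (P * B) = Q * P * B" using assms by (simp add: assoc_mult_mat[symmetric])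
  finally show ?thesis using assms by simp
qed

lemma upper_triangular_mult:
  assumes A: "A \<in> carrier_mat n n" "upper_triangular A"
    and B: "B \<in> carrier_mat n n" "upper_triangular B"
  shows "upper_triangular (A * B)"
    and "i < n \<Longrightarrow> (A * B) $$ (i, i) = A $$ (i, i) * B $$ (i, i)"
proof -
  \<comment> \<open>A nonzero term needs i \<le> k \<le> j. Below the diagonal no k qualifies, and
    on it only k = i.\<close>
  have z: "A $$ (i, k) * B $$ (k, j) = 0" if "i < n" "k < n" "j \<le> i" "k \<noteq> i \<or> j < i" for i j k
  proof (cases "k < i")
    case True
    then show ?thesis using A that upper_triangularD[of A k i] by auto
  next
    case False
    then have "j < k" using that by auto
    then show ?thesis using B that upper_triangularD[of B j k] by auto
  qed
  have e: "(A * B) $$ (i, j) = (\<Sum>k<n. A $$ (i, k) * B $$ (k, j))" if "i < n" "j < n" for i j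
    using A(1) B(1) that by (auto simp: scalar_prod_def atLeast0LessThan intro!: sum.cong)
  show "upper_triangular (A * B)"
  proof (rule upper_triangularI)
    fix i j assume ji: "j < i" "i < dim_row (A * B)"
    then have "i < n" using A by simp
    then show "(A * B) $$ (i, j) = 0"
      using ji z by (subst e) (auto intro!: sum.neutral)
  qed
  assume i: "i < n"
  have "(A * B) $$ (i, i) = (\<Sum>k<n. if k = i then A $$ (i, i) * B $$ (i, i) else 0)"
    unfolding e[OF i i] using i z[of i _ i] by (intro sum.cong) auto
  then show "(A * B) $$ (i, i) = A $$ (i, i) * B $$ (i, i)" using i by simp
qed

lemma upper_triangular_pow:
  fixes A :: "'a::comm_ring_1 mat"
  assumes A: "A \<in> carrier_mat n n" "upper_triangular A"
  shows "upper_triangular (A ^\<^sub>m k) \<and> (\<forall>i<n. (A ^\<^sub>m k) $$ (i, i) = A $$ (i, i) ^ k)"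
proof (induction k)
  case 0
  then show ?case using A by (auto simp del: upper_triangular_one intro: upper_triangularI)
next
  case (Suc k)
  have "A ^\<^sub>m k \<in> carrier_mat n n" using A by (auto simp: pow_mat_dim)
  then show ?case using Suc upper_triangular_mult[of "A ^\<^sub>m k" n A] A by (auto simp: mult.commute)
qed

section \<open>Compound matrices\<close>

text \<open>Compound matrices are indexed by positions in a list of lists; this converts sums over
  positions into sums over subsets K.\<close>

lemma bij_betw_subsets_of_size:
  "bij_betw (\<lambda>a. set (subsets_of_size n i ! a)) {..<length (subsets_of_size n i)}
     {K. K \<subseteq> {0..<n} \<and> card K = i}"
proof -
  let ?S = "subsets_of_size n i"
  have d: "distinct (map set (subseqs [0..<n]))"
    by (rule distinct_set_subseqs) simp
  have "distinct (map set ?S)"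
    using d unfolding subsets_of_size_def by (rule distinct_map_filter)
  moreover have "set (map set ?S) = {K. K \<subseteq> {0..<n} \<and> card K = i}"
  proof -
    have c: "card (set xs) = length xs" if "xs \<in> set (subseqs [0..<n])" for xs
      using subseqs_distinctD[OF that] by (simp add: distinct_card)
    have "set (map set ?S) = {K \<in> set ` set (subseqs [0..<n]). card K = i}"
      using c by (auto simp: subsets_of_size_def)
    also have "\<dots> = {K. K \<subseteq> {0..<n} \<and> card K = i}"
      by (auto simp: subseqs_powset)
    finally show ?thesis .
  qed
  ultimately have "bij_betw ((!) (map set ?S)) {..<length (map set ?S)} {K. K \<subseteq> {0..<n} \<and> card K = i}"
    by (intro bij_betw_nth) auto
  then show ?thesis
    by (subst bij_betw_cong[where g = "(!) (map set ?S)"]) auto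
qed

lemma subsets_of_size_nth:
  assumes "a < length (subsets_of_size n i)"
  shows "set (subsets_of_size n i ! a) \<subseteq> {0..<n}" "card (set (subsets_of_size n i ! a)) = i"
  using bij_betw_apply[OF bij_betw_subsets_of_size[of n i], of a] assms by auto

lemma submatrix_eq_mat:
  assumes "I \<subseteq> {0..<dim_row M}" "J \<subseteq> {0..<dim_col M}"
  shows "submatrix M I J = mat (card I) (card J) (\<lambda>(a, b). M $$ (pick I a, pick J b))"
proof -
  have "{i. i < dim_row M \<and> i \<in> I} = I" "{j. j < dim_col M \<and> j \<in> J} = J" using assms by auto
  then show ?thesis by (simp add: submatrix_def)
qed

lemma pick_less:
  assumes "I \<subseteq> {0..<n}" "card I = i" "a < i"
  shows "pick I a < n"
  using pick_in_set_le[of a I] assms by auto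

lemma ext_pow_mat_carrier:
  assumes "M \<in> carrier_mat n n"
  shows "ext_pow_mat i M \<in> carrier_mat (length (subsets_of_size n i)) (length (subsets_of_size n i))"
  using assms by (simp add: ext_pow_mat_def Let_def)

text \<open>A minor of M * N is the determinant of selected rows of M times selected columns of N.
  In the Cauchy-Binet sum for it, the sets K are exactly the inner indices of the product of the
  compounds.\<close>

lemma ext_pow_mat_mult:
  assumes M: "M \<in> carrier_mat n n" and N: "N \<in> carrier_mat n n"
  shows "ext_pow_mat i (M * N) = ext_pow_mat i M * ext_pow_mat i N"
proof (rule eq_matI)
  let ?S = "subsets_of_size n i"
  let ?l = "length ?S"
  let ?I = "\<lambda>a. set (?S ! a)"
  fix a b assume "a < dim_row (ext_pow_mat i M * ext_pow_mat i N)"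
    "b < dim_col (ext_pow_mat i M * ext_pow_mat i N)"
  then have a: "a < ?l" and b: "b < ?l" using M N by (auto simp: ext_pow_mat_def Let_def)
  note Ia = subsets_of_size_nth[OF a] and Ib = subsets_of_size_nth[OF b]
  let ?X = "mat i n (\<lambda>(p, q). M $$ (pick (?I a) p, q))"
  let ?Y = "mat n i (\<lambda>(p, q). N $$ (p, pick (?I b) q))"
  note pa = pick_less[OF Ia] and pb = pick_less[OF Ib]
  have XY: "submatrix (M * N) (?I a) (?I b) = ?X * ?Y"
    using M N Ia Ib pa pb by (subst submatrix_eq_mat) (auto intro!: eq_matI simp: scalar_prod_def)
  have "ext_pow_mat i (M * N) $$ (a, b) = det (?X * ?Y)"
    using M N a b by (simp add: ext_pow_mat_def Let_def XY[symmetric])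
  also have "\<dots> = (\<Sum>K | K \<subseteq> {0..<n} \<and> card K = i.
      det (mat i i (\<lambda>(p, q). ?X $$ (p, pick K q))) * det (mat i i (\<lambda>(p, q). ?Y $$ (pick K p, q))))"
    by (rule Cauchy_Binet) auto
  also have "\<dots> = (\<Sum>K | K \<subseteq> {0..<n} \<and> card K = i.
      det (submatrix M (?I a) K) * det (submatrix N K (?I b)))"
  proof (intro sum.cong refl arg_cong2[where f = "(*)"] arg_cong[where f = det])
    fix K assume "K \<in> {K. K \<subseteq> {0..<n} \<and> card K = i}"
    then have K: "K \<subseteq> {0..<n}" "card K = i" by auto
    note pk = pick_less[OF K]
    show "mat i i (\<lambda>(p, q). ?X $$ (p, pick K q)) = submatrix M (?I a) K"
      using M Ia K pa pk by (subst submatrix_eq_mat) (auto intro!: eq_matI)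
    show "mat i i (\<lambda>(p, q). ?Y $$ (pick K p, q)) = submatrix N K (?I b)"
      using N Ib K pb pk by (subst submatrix_eq_mat) (auto intro!: eq_matI)
  qed
  also have "\<dots> = (\<Sum>c<?l. det (submatrix M (?I a) (?I c)) * det (submatrix N (?I c) (?I b)))"
    by (rule sum.reindex_bij_betw[OF bij_betw_subsets_of_size, symmetric])
  also have "\<dots> = (ext_pow_mat i M * ext_pow_mat i N) $$ (a, b)"
    using M N a b by (auto simp: ext_pow_mat_def Let_def scalar_prod_def atLeast0LessThan intro!: sum.cong)
  finally show "ext_pow_mat i (M * N) $$ (a, b) = (ext_pow_mat i M * ext_pow_mat i N) $$ (a, b)" .
qed (use M N in \<open>auto simp: ext_pow_mat_def Let_def\<close>)

text \<open>Positive exponents suffice for the zeta function and start the induction at M itself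
  instead of at the compound of the identity.\<close>

lemma ext_pow_mat_pow:
  assumes M: "M \<in> carrier_mat n n"
  shows "ext_pow_mat i M ^\<^sub>m Suc k = ext_pow_mat i (M ^\<^sub>m Suc k)"
proof (induction k)
  case 0
  then show ?case using M ext_pow_mat_carrier[OF M, of i] by simp
next
  case (Suc k)
  have "ext_pow_mat i (M ^\<^sub>m Suc (Suc k)) = ext_pow_mat i (M ^\<^sub>m Suc k) * ext_pow_mat i M"
    using M by (subst pow_mat.simps) (intro ext_pow_mat_mult, auto)
  then show ?case using Suc by simp
qed

text \<open>The diagonal of the compound consists of the principal minors, and these are again
  triangular. The trace is therefore an elementary symmetric polynomial in the diagonal
  entries.\<close>

lemma mtrace_ext_pow_mat_upper_triangular:
  assumes T: "T \<in> carrier_mat n n" "upper_triangular T"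
  shows "mtrace (ext_pow_mat i T) = (\<Sum>K | K \<subseteq> {0..<n} \<and> card K = i. \<Prod>j\<in>K. T $$ (j, j))"
proof -
  let ?S = "subsets_of_size n i"
  have d: "det (submatrix T K K) = (\<Prod>j\<in>K. T $$ (j, j))" if K: "K \<subseteq> {0..<n}" "card K = i" for K
  proof -
    let ?U = "mat i i (\<lambda>(a, b). T $$ (pick K a, pick K b))"
    have "upper_triangular ?U"
      using T pick_less[OF K] pick_mono_le[of _ K] K
      by (auto intro!: upper_triangularI upper_triangularD[OF T(2)])
    then have "det ?U = prod_list (diag_mat ?U)" by (rule det_upper_triangular) auto
    also have "\<dots> = (\<Prod>a=0..<i. T $$ (pick K a, pick K a))" by (simp add: prod_list_diag_prod)
    also have "\<dots> = (\<Prod>j\<in>K. T $$ (j, j))"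
      using K by (intro prod.reindex_bij_betw bij_betw_pick) (auto intro: finite_subset)
    finally show ?thesis using T K by (simp add: submatrix_eq_mat)
  qed
  have "mtrace (ext_pow_mat i T) = (\<Sum>a<length ?S. det (submatrix T (set (?S ! a)) (set (?S ! a))))"
    using T by (auto simp: mtrace_def ext_pow_mat_def Let_def)
  also have "\<dots> = (\<Sum>K | K \<subseteq> {0..<n} \<and> card K = i. det (submatrix T K K))"
    by (rule sum.reindex_bij_betw[OF bij_betw_subsets_of_size])
  also have "\<dots> = (\<Sum>K | K \<subseteq> {0..<n} \<and> card K = i. \<Prod>j\<in>K. T $$ (j, j))"
    by (intro sum.cong refl d) auto
  finally show ?thesis .
qed

section \<open>Eigenvalues\<close>

text \<open>A single Schur decomposition serves all the claims, so that traces, determinants and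
  compound traces refer to one list of eigenvalues with multiplicity.\<close>

lemma eigenvalue_list:
  fixes M :: "complex mat"
  assumes M: "M \<in> carrier_mat n n"
  obtains es where "length es = n" "char_poly M = (\<Prod>e\<leftarrow>es. [:- e, 1:])"
    "\<And>k. mtrace (M ^\<^sub>m k) = (\<Sum>j<n. es ! j ^ k)"
    "\<And>x k. det (1\<^sub>m n - x \<cdot>\<^sub>m (M ^\<^sub>m k)) = (\<Prod>j<n. 1 - x * es ! j ^ k)"
    "\<And>i k. k > 0 \<Longrightarrow> mtrace (ext_pow_mat i M ^\<^sub>m k) =
       (\<Sum>K | K \<subseteq> {0..<n} \<and> card K = i. \<Prod>j\<in>K. es ! j ^ k)"
proof -
  obtain es where es: "char_poly M = (\<Prod>e\<leftarrow>es. [:- e, 1:])" "length es = n"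
    using char_poly_factorized[OF M] by blast
  obtain T P Q where "schur_decomposition M es = (T, P, Q)" by (metis prod_cases3)
  from schur_decomposition[OF M es(1) this]
  have wit: "similar_mat_wit M T P Q" and ut: "upper_triangular T" and diag: "diag_mat T = es"
    by auto
  note w = similar_mat_witD2[OF M wit]
  have T: "T $$ (j, j) = es ! j" if "j < n" for j
    using that w(5) unfolding diag[symmetric] by (simp add: diag_mat_def)
  have powT: "(T ^\<^sub>m k) $$ (j, j) = es ! j ^ k" if "j < n" for j k
    using upper_triangular_pow[OF w(5) ut, of k] T that by simp
  have utk: "upper_triangular (T ^\<^sub>m k)" for k
    using upper_triangular_pow[OF w(5) ut, of k] by simp
  have pw: "M ^\<^sub>m k = P * T ^\<^sub>m k * Q" for k
    by (rule similar_mat_wit_pow_id[OF wit])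
  have Tk: "T ^\<^sub>m k \<in> carrier_mat n n" for k using w(5) by simp
  have PQc: "P * T ^\<^sub>m k \<in> carrier_mat n n" for k using w(6) Tk by simp
  have tr: "mtrace (M ^\<^sub>m k) = (\<Sum>j<n. es ! j ^ k)" for k
  proof -
    have "mtrace (M ^\<^sub>m k) = mtrace (T ^\<^sub>m k)"
      unfolding pw by (rule mtrace_conj[OF w(6) Tk w(7) w(2)])
    also have "\<dots> = (\<Sum>j<n. es ! j ^ k)" using Tk[of k] powT by (auto simp: mtrace_def)
    finally show ?thesis .
  qed
  have dt: "det (1\<^sub>m n - x \<cdot>\<^sub>m (M ^\<^sub>m k)) = (\<Prod>j<n. 1 - x * es ! j ^ k)" for x k
  proof -
    let ?B = "1\<^sub>m n - x \<cdot>\<^sub>m (T ^\<^sub>m k)"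
    have B: "?B \<in> carrier_mat n n"
      by (rule minus_carrier_mat[OF smult_carrier_mat[OF Tk]])
    have xT: "x \<cdot>\<^sub>m (T ^\<^sub>m k) \<in> carrier_mat n n" by (rule smult_carrier_mat[OF Tk])
    have "P * ?B * Q = (P * 1\<^sub>m n - P * (x \<cdot>\<^sub>m (T ^\<^sub>m k))) * Q"
      by (simp only: mult_minus_distrib_mat[OF w(6) one_carrier_mat xT])
    also have "\<dots> = P * 1\<^sub>m n * Q - P * (x \<cdot>\<^sub>m (T ^\<^sub>m k)) * Q"
      by (rule minus_mult_distrib_mat[OF mult_carrier_mat[OF w(6) one_carrier_mat]
            mult_carrier_mat[OF w(6) xT] w(7)])
    also have "P * (x \<cdot>\<^sub>m (T ^\<^sub>m k)) * Q = x \<cdot>\<^sub>m (M ^\<^sub>m k)"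
      unfolding pw using w Tk[of k] PQc[of k]
      by (subst mult_smult_distrib[of _ n n]) (auto intro!: mult_smult_assoc_mat[of _ n n])
    also have "P * 1\<^sub>m n * Q = 1\<^sub>m n" using w by simp
    finally have "similar_mat (1\<^sub>m n - x \<cdot>\<^sub>m (M ^\<^sub>m k)) ?B"
      using w B M by (intro similar_matI[of _ _ P Q n]) auto
    then have "det (1\<^sub>m n - x \<cdot>\<^sub>m (M ^\<^sub>m k)) = det ?B" by (rule det_similar)
    also have "upper_triangular ?B"
    proof (rule upper_triangularI)
      fix i j assume "j < i" "i < dim_row ?B"
      then show "?B $$ (i, j) = 0"
        using upper_triangularD[OF utk[of k], of j i] carrier_matD[OF Tk[of k]] by simp
    qed
    then have "det ?B = prod_list (diag_mat ?B)" using B by (rule det_upper_triangular)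
    also have "\<dots> = (\<Prod>j<n. 1 - x * es ! j ^ k)"
      using w(5) powT by (auto simp: prod_list_diag_prod atLeast0LessThan intro!: prod.cong)
    finally show ?thesis .
  qed
  have ext: "mtrace (ext_pow_mat i M ^\<^sub>m k) =
       (\<Sum>K | K \<subseteq> {0..<n} \<and> card K = i. \<Prod>j\<in>K. es ! j ^ k)" if "k > 0" for i k
  proof -
    note c = ext_pow_mat_carrier[where n = n and i = i]
    obtain k' where k': "k = Suc k'" using \<open>k > 0\<close> by (cases k) auto
    have "ext_pow_mat i M ^\<^sub>m k = ext_pow_mat i (P * T ^\<^sub>m k * Q)"
      unfolding k' ext_pow_mat_pow[OF M] pw[symmetric] ..
    also have "\<dots> = ext_pow_mat i P * (ext_pow_mat i (T ^\<^sub>m k) * ext_pow_mat i Q)"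
      using ext_pow_mat_mult[OF PQc w(7)] ext_pow_mat_mult[OF w(6) Tk]
        assoc_mult_mat[OF c[OF w(6)] c[OF Tk] c[OF w(7)]] by simp
    \<comment> \<open>Under the trace the compound of P moves cyclically next to that of Q, and the
      whole product is again one compound. Thus no inverse of a compound matrix has to be
      exhibited.\<close>
    also have "mtrace \<dots> = mtrace (ext_pow_mat i (T ^\<^sub>m k) * ext_pow_mat i Q * ext_pow_mat i P)"
      by (rule mtrace_mult_comm[OF c[OF w(6)] mult_carrier_mat[OF c[OF Tk] c[OF w(7)]]])
    also have "ext_pow_mat i (T ^\<^sub>m k) * ext_pow_mat i Q * ext_pow_mat i P
        = ext_pow_mat i (T ^\<^sub>m k * Q * P)"
      using ext_pow_mat_mult[OF mult_carrier_mat[OF Tk w(7)] w(6)] ext_pow_mat_mult[OF Tk w(7)] by simp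
    also have "T ^\<^sub>m k * Q * P = T ^\<^sub>m k" using w Tk[of k] by (simp add: assoc_mult_mat[of _ n n _ n _ n])
    also have "mtrace (ext_pow_mat i (T ^\<^sub>m k)) =
       (\<Sum>K | K \<subseteq> {0..<n} \<and> card K = i. \<Prod>j\<in>K. (T ^\<^sub>m k) $$ (j, j))"
      by (rule mtrace_ext_pow_mat_upper_triangular[OF Tk utk])
    also have "\<dots> = (\<Sum>K | K \<subseteq> {0..<n} \<and> card K = i. \<Prod>j\<in>K. es ! j ^ k)"
      using powT by (intro sum.cong prod.cong) auto
    finally show ?thesis .
  qed
  show thesis by (rule that[OF es(2,1) tr dt ext])
qed

text \<open>Expanding the product of the 1 - e^k over the eigenvalues gives one term per set K of
  eigenvalues; grouping by the size i of K produces the compound traces with sign (-1)^i.\<close>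

lemma det_one_minus_pow_eq_sum_mtrace:
  fixes M :: "complex mat"
  assumes M: "M \<in> carrier_mat n n" and k: "k > 0"
  shows "det (1\<^sub>m n - M ^\<^sub>m k) = (\<Sum>i\<in>{0..n}. (-1) ^ i * mtrace (ext_pow_mat i M ^\<^sub>m k))"
proof -
  obtain es where es: "\<And>x k. det (1\<^sub>m n - x \<cdot>\<^sub>m (M ^\<^sub>m k)) = (\<Prod>j<n. 1 - x * es ! j ^ k)"
    "\<And>i k. k > 0 \<Longrightarrow> mtrace (ext_pow_mat i M ^\<^sub>m k) =
       (\<Sum>K | K \<subseteq> {0..<n} \<and> card K = i. \<Prod>j\<in>K. es ! j ^ k)"
    by (rule eigenvalue_list[OF M]) (rule that, assumption+)
  have "1 \<cdot>\<^sub>m (M ^\<^sub>m k) = M ^\<^sub>m k" by (intro eq_matI) auto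
  then have "det (1\<^sub>m n - M ^\<^sub>m k) = (\<Prod>j\<in>{0..<n}. - (es ! j ^ k) + 1)"
    using es(1)[of 1 k] by (simp add: atLeast0LessThan)
  also have "\<dots> = (\<Sum>K\<in>Pow {0..<n}. \<Prod>j\<in>K. - (es ! j ^ k))"
    by (subst prod_add) auto
  also have "\<dots> = (\<Sum>i\<in>{0..n}. \<Sum>K\<in>{K\<in>Pow {0..<n}. card K = i}. \<Prod>j\<in>K. - (es ! j ^ k))"
    by (rule sum.group[symmetric]) (auto dest: card_mono[rotated])
  also have "\<dots> = (\<Sum>i\<in>{0..n}. (-1) ^ i * mtrace (ext_pow_mat i M ^\<^sub>m k))"
    unfolding es(2)[OF k] sum_distrib_left
    by (intro sum.cong) (auto simp: prod_uminus)
  finally show ?thesis .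
qed

lemma det_one_minus_eq_prod:
  fixes M :: "complex mat"
  assumes M: "M \<in> carrier_mat n n"
  obtains es where "det_one_minus M c = (\<Prod>e\<leftarrow>es. [:1, - c * e:])"
    "\<And>k. mtrace (M ^\<^sub>m k) = (\<Sum>e\<leftarrow>es. e ^ k)"
proof -
  obtain es where es: "length es = n" "\<And>k. mtrace (M ^\<^sub>m k) = (\<Sum>j<n. es ! j ^ k)"
    "\<And>x k. det (1\<^sub>m n - x \<cdot>\<^sub>m (M ^\<^sub>m k)) = (\<Prod>j<n. 1 - x * es ! j ^ k)"
    by (rule eigenvalue_list[OF M]) (rule that, assumption+)
  \<comment> \<open>Complex polynomials that agree everywhere are equal, so the determinant over
    polynomials is compared with the scalar determinant of 1 - c z M at each z.\<close>
  have "poly (det_one_minus M c) z = poly (\<Prod>e\<leftarrow>es. [:1, - c * e:]) z" for z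
  proof -
    have "poly (det_one_minus M c) z = det (1\<^sub>m n - (c * z) \<cdot>\<^sub>m (M ^\<^sub>m 1))"
      unfolding det_one_minus_def comm_ring_hom.hom_det[OF poly_hom.comm_ring_hom_axioms, symmetric]
      by (rule arg_cong[where f = det], rule eq_matI) (use M in \<open>auto simp: mult_ac\<close>)
    also have "\<dots> = (\<Prod>j<n. 1 - c * z * es ! j)" unfolding es by simp
    also have "\<dots> = (\<Prod>e\<leftarrow>es. 1 - c * z * e)"
      using es(1) by (simp add: prod.list_conv_set_nth atLeast0LessThan)
    also have "\<dots> = poly (\<Prod>e\<leftarrow>es. [:1, - c * e:]) z"
      by (simp add: poly_prod_list o_def mult_ac)
    finally show ?thesis .
  qed
  then have "det_one_minus M c = (\<Prod>e\<leftarrow>es. [:1, - c * e:])" by (simp add: poly_eq_poly_eq_iff[symmetric] fun_eq_iff)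
  moreover have "mtrace (M ^\<^sub>m k) = (\<Sum>e\<leftarrow>es. e ^ k)" for k
    using es by (simp add: sum.list_conv_set_nth atLeast0LessThan)
  ultimately show thesis using that by blast
qed

section \<open>Kronecker products\<close>

text \<open>The index c = a * n + b encodes the pair (a, b); this is the row and column numbering of
  \<open>kron\<close>.\<close>

lemma sum_div_mod:
  fixes f :: "nat \<Rightarrow> nat \<Rightarrow> 'a::comm_monoid_add"
  shows "(\<Sum>c<m * n. f (c div n) (c mod n)) = (\<Sum>a<m. \<Sum>b<n. f a b)"
proof -
  have "(\<Sum>c<m * n. f (c div n) (c mod n)) = (\<Sum>(a, b)\<in>{..<m} \<times> {..<n}. f a b)"
  proof (rule sum.reindex_bij_witness[where i = "\<lambda>(a, b). a * n + b" and j = "\<lambda>c. (c div n, c mod n)"])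
    fix c assume "c \<in> {..<m * n}"
    then have c: "c < m * n" by simp
    then have "n > 0" by (cases n) auto
    then show "(c div n, c mod n) \<in> {..<m} \<times> {..<n}" using c by (simp add: less_mult_imp_div_less)
  next
    fix x assume "x \<in> {..<m} \<times> {..<n}"
    then obtain a b where x: "x = (a, b)" "a < m" "b < n" by auto
    have "a * n + b < (a + 1) * n" using x by simp
    also have "\<dots> \<le> m * n" using x by (intro mult_right_mono) auto
    finally show "(case x of (a, b) \<Rightarrow> a * n + b) \<in> {..<m * n}" using x by simp
    show "((case x of (a, b) \<Rightarrow> a * n + b) div n, (case x of (a, b) \<Rightarrow> a * n + b) mod n) = x"
      using x by simp
  qed auto
  then show ?thesis by (simp add: sum.cartesian_product)
qed

lemma kron_carrier:
  assumes "M \<in> carrier_mat m m" "N \<in> carrier_mat n n"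
  shows "kron M N \<in> carrier_mat (m * n) (m * n)"
  using assms by (simp add: kron_def Let_def)

lemma kron_index:
  assumes "M \<in> carrier_mat m m" "N \<in> carrier_mat n n" "a < m * n" "b < m * n"
  shows "kron M N $$ (a, b) = M $$ (a div n, b div n) * N $$ (a mod n, b mod n)"
  using assms by (simp add: kron_def Let_def)

lemma kron_mult:
  assumes M: "M \<in> carrier_mat m m" "M' \<in> carrier_mat m m"
    and N: "N \<in> carrier_mat n n" "N' \<in> carrier_mat n n"
  shows "kron (M * M') (N * N') = kron M N * kron M' N'"
proof (rule eq_matI)
  fix a b assume "a < dim_row (kron M N * kron M' N')" "b < dim_col (kron M N * kron M' N')"
  then have ab: "a < m * n" "b < m * n" using assms by (auto simp: kron_def Let_def)
  then have "n > 0" by (cases n) auto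
  then have dm: "a div n < m" "b div n < m" "a mod n < n" "b mod n < n"
    using ab by (auto simp: less_mult_imp_div_less)
  have "(kron M N * kron M' N') $$ (a, b) = (\<Sum>c<m * n. kron M N $$ (a, c) * kron M' N' $$ (c, b))"
    using ab kron_carrier[OF M(1) N(1)] kron_carrier[OF M(2) N(2)]
    by (auto simp: scalar_prod_def atLeast0LessThan intro!: sum.cong)
  also have "\<dots> = (\<Sum>c<m * n. (\<lambda>p q. M $$ (a div n, p) * N $$ (a mod n, q) *
       (M' $$ (p, b div n) * N' $$ (q, b mod n))) (c div n) (c mod n))"
    using ab M N by (intro sum.cong refl) (simp add: kron_index)
  also have "\<dots> = (\<Sum>p<m. \<Sum>q<n. M $$ (a div n, p) * N $$ (a mod n, q) *
       (M' $$ (p, b div n) * N' $$ (q, b mod n)))" by (rule sum_div_mod)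
  also have "\<dots> = (\<Sum>p<m. M $$ (a div n, p) * M' $$ (p, b div n)) *
      (\<Sum>q<n. N $$ (a mod n, q) * N' $$ (q, b mod n))"
    by (simp add: sum_product mult_ac)
  also have "(\<Sum>p<m. M $$ (a div n, p) * M' $$ (p, b div n)) = (M * M') $$ (a div n, b div n)"
    using M dm by (auto simp: scalar_prod_def atLeast0LessThan intro!: sum.cong)
  also have "(\<Sum>q<n. N $$ (a mod n, q) * N' $$ (q, b mod n)) = (N * N') $$ (a mod n, b mod n)"
    using N dm by (auto simp: scalar_prod_def atLeast0LessThan intro!: sum.cong)
  also have "(M * M') $$ (a div n, b div n) * (N * N') $$ (a mod n, b mod n)
      = kron (M * M') (N * N') $$ (a, b)"
    using M N ab by (intro kron_index[symmetric]) auto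
  finally show "kron (M * M') (N * N') $$ (a, b) = (kron M N * kron M' N') $$ (a, b)" by simp
qed (use assms in \<open>auto simp: kron_def Let_def\<close>)

lemma kron_pow:
  assumes M: "M \<in> carrier_mat m m" and N: "N \<in> carrier_mat n n"
  shows "kron M N ^\<^sub>m Suc k = kron (M ^\<^sub>m Suc k) (N ^\<^sub>m Suc k)"
proof (induction k)
  case 0
  then show ?case using M N kron_carrier[OF M N] by simp
next
  case (Suc k)
  have "kron (M ^\<^sub>m Suc (Suc k)) (N ^\<^sub>m Suc (Suc k)) = kron (M ^\<^sub>m Suc k) (N ^\<^sub>m Suc k) * kron M N"
    using M N by (subst (1 2) pow_mat.simps(2)) (intro kron_mult, auto)
  then show ?case using Suc by simp
qed

lemma mtrace_kron:
  assumes M: "M \<in> carrier_mat m m" and N: "N \<in> carrier_mat n n"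
  shows "mtrace (kron M N) = mtrace M * mtrace N"
proof -
  have "mtrace (kron M N) = (\<Sum>c<m * n. (\<lambda>p q. M $$ (p, p) * N $$ (q, q)) (c div n) (c mod n))"
    using kron_carrier[OF M N] kron_index[OF M N] by (auto simp: mtrace_def)
  also have "\<dots> = (\<Sum>p<m. \<Sum>q<n. M $$ (p, p) * N $$ (q, q))" by (rule sum_div_mod)
  also have "\<dots> = mtrace M * mtrace N" using M N by (simp add: mtrace_def sum_product)
  finally show ?thesis .
qed

section \<open>Exponentials of power series\<close>

text \<open>In characteristic 0 the equation G' = f' G with a given constant term has only one
  solution, and exp f solves it with constant term 1. All exponential identities below are obtained
  in this way.\<close>

lemma fps_exp_compose_eqI:
  fixes f G :: "'a::field_char_0 fps"
  assumes f: "fps_nth f 0 = 0" and G: "fps_nth G 0 = 1" "fps_deriv G = fps_deriv f * G"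
  shows "fps_exp 1 oo f = G"
proof -
  define D where "D = (fps_exp 1 oo f) - G"
  have D0: "fps_nth D 0 = 0" using G by (simp add: D_def)
  have dD: "fps_deriv D = fps_deriv f * D"
    using fps_compose_deriv[OF f, of "fps_exp 1"] G(2) by (simp add: D_def algebra_simps)
  have "fps_nth D n = 0" for n
  proof (induction n rule: less_induct)
    case (less n)
    show ?case
    proof (cases n)
      case (Suc m)
      \<comment> \<open>The coefficient of f' D at m involves only the coefficients of D up to m,
        which vanish by induction.\<close>
      have "of_nat (Suc m) * fps_nth D (Suc m) = fps_nth (fps_deriv f * D) m"
        using dD by (metis fps_deriv_nth Suc_eq_plus1)
      also have "\<dots> = 0" using less Suc by (simp add: fps_mult_nth)
      finally show ?thesis using Suc by (simp del: of_nat_Suc)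
    qed (use D0 in simp)
  qed
  then have "D = 0" by (simp add: fps_eq_iff)
  then show ?thesis by (simp add: D_def)
qed

lemma fps_exp_compose_add:
  fixes f g :: "'a::field_char_0 fps"
  assumes f: "fps_nth f 0 = 0" and g: "fps_nth g 0 = 0"
  shows "fps_exp 1 oo (f + g) = (fps_exp 1 oo f) * (fps_exp 1 oo g)"
  using f g fps_compose_deriv[OF f, of "fps_exp 1"] fps_compose_deriv[OF g, of "fps_exp 1"]
  by (intro fps_exp_compose_eqI) (auto simp: algebra_simps)

lemma fps_exp_compose_0: "fps_exp 1 oo (0 :: 'a::field_char_0 fps) = 1"
  by (rule fps_exp_compose_eqI) auto

lemma fps_exp_compose_uminus:
  fixes f :: "'a::field_char_0 fps"
  assumes f: "fps_nth f 0 = 0"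
  shows "fps_exp 1 oo (- f) = inverse (fps_exp 1 oo f)"
proof -
  have "(fps_exp 1 oo f) * (fps_exp 1 oo (- f)) = 1"
    using fps_exp_compose_add[of f "- f"] f by (simp add: fps_exp_compose_0)
  then show ?thesis by (rule fps_inverse_unique[symmetric])
qed

lemma fps_exp_compose_sum:
  fixes f :: "'i \<Rightarrow> 'a::field_char_0 fps"
  assumes "\<And>i. i \<in> I \<Longrightarrow> fps_nth (f i) 0 = 0"
  shows "fps_exp 1 oo (\<Sum>i\<in>I. f i) = (\<Prod>i\<in>I. fps_exp 1 oo f i)"
  using assms
  by (induction I rule: infinite_finite_induct)
    (auto simp: fps_exp_compose_0 fps_exp_compose_add fps_sum_nth)

text \<open>The exponent of a zeta function. The coefficient at 0 is fixed to 0, so that composition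
  with exp is legitimate and facts about positive powers determine the series.\<close>

definition log_series :: "(nat \<Rightarrow> 'a::field_char_0) \<Rightarrow> 'a fps" where
  "log_series a = Abs_fps (\<lambda>n. if n = 0 then 0 else a n / of_nat n)"

lemma log_series_0 [simp]: "fps_nth (log_series a) 0 = 0"
  by (simp add: log_series_def)

lemma log_series_cong: "(\<And>n. n > 0 \<Longrightarrow> a n = b n) \<Longrightarrow> log_series a = log_series b"
  by (auto simp: log_series_def fps_eq_iff)

text \<open>The exponent is - log (1 - e z), so its exponential is the geometric series G.\<close>

lemma fps_exp_log_series_power:
  fixes e :: "'a::field_char_0"
  shows "fps_exp 1 oo log_series (\<lambda>n. e ^ n) = inverse (fps_of_poly [:1, - e:])"
proof -
  define G where "G = Abs_fps (\<lambda>n. e ^ n)"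
  have "fps_of_poly [:1, - e:] * G = 1"
  proof (rule fps_ext)
    fix n show "fps_nth (fps_of_poly [:1, - e:] * G) n = fps_nth 1 n"
      by (cases n) (auto simp: fps_of_poly_pCons algebra_simps G_def fps_mult_nth_1
        simp flip: fps_mult_fps_X_commute)
  qed
  then have inv: "inverse (fps_of_poly [:1, - e:]) = G" by (rule fps_inverse_unique)
  have "fps_exp 1 oo log_series (\<lambda>n. e ^ n) = G"
  proof (rule fps_exp_compose_eqI)
    have "fps_nth (fps_deriv G) n = fps_nth (fps_deriv (log_series (\<lambda>n. e ^ n)) * G) n" for n
    proof -
      have "fps_nth (fps_deriv (log_series (\<lambda>n. e ^ n)) * G) n = (\<Sum>i=0..n. e ^ Suc i * e ^ (n - i))"
        unfolding fps_mult_nth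
        by (intro sum.cong) (auto simp: log_series_def G_def simp del: of_nat_Suc of_nat_add)
      also have "\<dots> = (\<Sum>i=0..n. e ^ Suc n)"
        by (intro sum.cong refl) (simp flip: power_add)
      finally show ?thesis by (simp add: G_def)
    qed
    then show "fps_deriv G = fps_deriv (log_series (\<lambda>n. e ^ n)) * G" by (rule fps_ext)
  qed (auto simp: G_def)
  then show ?thesis by (simp add: inv)
qed

text \<open>A trace is a sum over eigenvalues, which exp turns into a product of the one-eigenvalue
  cases; the scalar is absorbed by c^k e^k = (c e)^k.\<close>

lemma fps_exp_log_series_mtrace:
  assumes M: "M \<in> carrier_mat n n"
  shows "fps_exp 1 oo log_series (\<lambda>k. c ^ k * mtrace (M ^\<^sub>m k))
       = inverse (fps_of_poly (det_one_minus M c))"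
proof -
  obtain es where es: "det_one_minus M c = (\<Prod>e\<leftarrow>es. [:1, - c * e:])"
    "\<And>k. mtrace (M ^\<^sub>m k) = (\<Sum>e\<leftarrow>es. e ^ k)"
    by (rule det_one_minus_eq_prod[OF M, where c = c]) (rule that, assumption+)
  \<comment> \<open>Claimed for an arbitrary list, because \<open>es\<close> is tied to M and cannot
    be shortened in an induction.\<close>
  have "fps_exp 1 oo log_series (\<lambda>k. \<Sum>e\<leftarrow>xs. (c * e) ^ k)
      = inverse (fps_of_poly (\<Prod>e\<leftarrow>xs. [:1, - (c * e):]))" for xs
  proof (induction xs)
    case Nil
    have "log_series (\<lambda>k. \<Sum>e\<leftarrow>[]. (c * e) ^ k) = 0"
      by (simp add: log_series_def fps_eq_iff)
    then show ?case by (simp add: fps_exp_compose_0)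
  next
    case (Cons x xs)
    have "log_series (\<lambda>k. \<Sum>e\<leftarrow>x # xs. (c * e) ^ k)
        = log_series (\<lambda>k. (c * x) ^ k) + log_series (\<lambda>k. \<Sum>e\<leftarrow>xs. (c * e) ^ k)"
      by (simp add: log_series_def fps_eq_iff add_divide_distrib)
    then show ?case
      by (simp only: fps_exp_compose_add log_series_0 Cons.IH fps_exp_log_series_power
          list.map prod_list.Cons fps_of_poly_mult fps_inverse_mult)
  qed
  moreover have "c ^ k * mtrace (M ^\<^sub>m k) = (\<Sum>e\<leftarrow>es. (c * e) ^ k)" for k
    unfolding es by (simp add: power_mult_distrib sum_list_const_mult)
  ultimately show ?thesis by (simp add: es)
qed

text \<open>Constant term 1 makes these determinants units among power series, so that inverting
  them is meaningful.\<close>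

lemma det_one_minus_0:
  assumes M: "M \<in> carrier_mat n n"
  shows "poly (det_one_minus M c) 0 = 1"
proof -
  obtain es where es: "det_one_minus M c = (\<Prod>e\<leftarrow>es. [:1, - c * e:])"
    by (rule det_one_minus_eq_prod[OF M, where c = c]) (rule that)
  show ?thesis unfolding es by (induction es) auto
qed

text \<open>A sign in the exponent becomes a power +1 or -1 of the exponential; this is how
  \<open>fps_pm\<close> enters.\<close>

lemma fps_exp_compose_sign:
  assumes "fps_nth f 0 = 0"
  shows "fps_exp 1 oo (fps_const ((-1) ^ j) * f) = fps_pm (even j) (fps_exp 1 oo f)"
  using assms by (cases "even j") (auto simp: fps_pm_def fps_exp_compose_uminus simp flip: fps_const_neg)

section \<open>Rational power series\<close>

text \<open>Both constant terms are required to be nonzero, so that the class is closed under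
  \<open>inverse\<close> and the quotient is by a unit.\<close>

definition fps_rational :: "complex fps \<Rightarrow> bool" where
  "fps_rational f \<longleftrightarrow>
     (\<exists>P Q. poly P 0 \<noteq> 0 \<and> poly Q 0 \<noteq> 0 \<and> f = fps_of_poly P / fps_of_poly Q)"

lemma fps_rational_of_poly: "poly P 0 \<noteq> 0 \<Longrightarrow> fps_rational (fps_of_poly P)"
  unfolding fps_rational_def by (rule exI[of _ P], rule exI[of _ 1]) auto

lemma fps_rational_mult:
  assumes "fps_rational f" "fps_rational g"
  shows "fps_rational (f * g)"
proof -
  obtain P Q where f: "poly P 0 \<noteq> 0" "poly Q 0 \<noteq> 0" "f = fps_of_poly P / fps_of_poly Q"
    using assms(1) by (auto simp: fps_rational_def)
  obtain P' Q' where g: "poly P' 0 \<noteq> 0" "poly Q' 0 \<noteq> 0" "g = fps_of_poly P' / fps_of_poly Q'"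
    using assms(2) by (auto simp: fps_rational_def)
  have "f * g = fps_of_poly (P * P') / fps_of_poly (Q * Q')"
    using f g by (simp add: fps_divide_unit fps_of_poly_mult fps_inverse_mult poly_0_coeff_0 mult_ac
        coeff_mult_0)
  then show ?thesis unfolding fps_rational_def using f g
    by (intro exI[of _ "P * P'"] exI[of _ "Q * Q'"]) auto
qed

lemma fps_rational_inverse:
  assumes "fps_rational f"
  shows "fps_rational (inverse f)"
proof -
  obtain P Q where f: "poly P 0 \<noteq> 0" "poly Q 0 \<noteq> 0" "f = fps_of_poly P / fps_of_poly Q"
    using assms by (auto simp: fps_rational_def)
  have "inverse f = fps_of_poly Q / fps_of_poly P"
    using f by (simp add: fps_divide_unit fps_inverse_mult poly_0_coeff_0 mult_ac)
  then show ?thesis unfolding fps_rational_def using f by blast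
qed

lemma fps_rational_pm: "fps_rational f \<Longrightarrow> fps_rational (fps_pm b f)"
  by (simp add: fps_pm_def fps_rational_inverse)

lemma fps_rational_prod:
  "(\<And>i. i \<in> I \<Longrightarrow> fps_rational (f i)) \<Longrightarrow> fps_rational (\<Prod>i\<in>I. f i)"
proof (induction I rule: infinite_finite_induct)
  case (infinite I)
  then show ?case using fps_rational_of_poly[of 1] by simp
next
  case empty
  then show ?case using fps_rational_of_poly[of 1] by simp
qed (auto intro: fps_rational_mult)

section \<open>The sign of the determinant\<close>

text \<open>Counting in the multiset of roots permits induction on that multiset in the sign
  computation.\<close>

lemma num_eigs_eq_size:
  assumes "M \<in> carrier_mat n n"
  shows "num_eigs M P = size (filter_mset P (proots (char_poly M)))"
proof -
  let ?q = "char_poly M"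
  have q: "?q \<noteq> 0" using degree_monic_char_poly[OF assms] by auto
  have "size (filter_mset P (proots ?q))
      = (\<Sum>\<mu>\<in>{\<mu>. poly ?q \<mu> = 0 \<and> P \<mu>}. count (filter_mset P (proots ?q)) \<mu>)"
    unfolding size_multiset_overloaded_eq using q by (intro sum.cong) auto
  also have "\<dots> = num_eigs M P"
    unfolding num_eigs_def using q by (intro sum.cong) auto
  finally show ?thesis by simp
qed

lemma proots_linear_factors:
  fixes xs :: "'a::idom list"
  shows "proots (\<Prod>x\<leftarrow>xs. [:- x, 1:]) = mset xs"
proof (induction xs)
  case (Cons x xs)
  have "[:- x, 1:] * (\<Prod>x\<leftarrow>xs. [:- x, 1:]) \<noteq> 0"
    by (intro no_zero_divisors) (auto simp: prod_list_zero_iff)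
  then have "proots ([:- x, 1:] * (\<Prod>x\<leftarrow>xs. [:- x, 1:])) = {#x#} + mset xs"
    by (subst proots_mult) (simp_all add: Cons.IH del: mult_pCons_left)
  then show ?case by simp
qed auto

text \<open>Conjugating the factorization into linear factors conjugates each root and leaves the
  polynomial as it is.\<close>

lemma proots_cnj:
  fixes q :: "complex poly"
  assumes "map_poly cnj q = q"
  shows "image_mset cnj (proots q) = proots q"
proof (cases "q = 0")
  case False
  obtain xs where xs: "mset xs = proots q" by (metis ex_mset)
  interpret cnj: inj_comm_ring_hom cnj by unfold_locales auto
  interpret map_poly_cnj: map_poly_inj_comm_ring_hom cnj ..
  have q: "q = Polynomial.smult (lead_coeff q) (\<Prod>x\<leftarrow>xs. [:- x, 1:])"
    using complex_poly_decompose_multiset[of q] by (simp add: xs[symmetric] prod_mset_prod_list flip: mset_map)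
  have "q = map_poly cnj q" using assms by simp
  also have "\<dots> = Polynomial.smult (cnj (lead_coeff q)) (\<Prod>x\<leftarrow>xs. [:- cnj x, 1:])"
    by (subst q) (simp add: map_poly_cnj.hom_prod_list map_poly_pCons o_def hom_distribs)
  finally have "proots q = proots (\<Prod>x\<leftarrow>map cnj xs. [:- x, 1:])"
    using False by (metis (no_types, lifting) complex_cnj_zero_iff leading_coeff_0_iff
        map_map o_def proots_smult map_eq_conv)
  also have "\<dots> = mset (map cnj xs)" by (rule proots_linear_factors)
  finally show ?thesis by (simp only: xs[symmetric] mset_map)
qed simp

text \<open>For real x, the number 1 - x^n is nonnegative if \<bar>x\<bar> \<le> 1 and nonpositive
  if x > 1. For x < -1 its sign alternates with n, which the second factor corrects. Summed over the
  eigenvalues these two signs yield r and p.\<close>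

lemma sign_real_factor:
  fixes e :: complex
  assumes "e \<in> \<real>"
  shows "of_real (norm (1 - e ^ n)) = (if norm e > 1 then -1 else 1) *
     (if Re e < -1 then (-1) ^ n else 1) * (1 - e ^ n)"
proof -
  obtain x where e: "e = of_real x" using assms by (auto elim: Reals_cases)
  have "\<bar>1 - x ^ n\<bar> = (if \<bar>x\<bar> > 1 then -1 else 1) * (if x < -1 then (-1) ^ n else 1) * (1 - x ^ n)"
  proof (cases "\<bar>x\<bar> > 1")
    case False
    then have "\<bar>x ^ n\<bar> \<le> 1" by (simp add: power_abs power_le_one)
    then show ?thesis using False by auto
  next
    case True
    show ?thesis
    proof (cases "x > 0")
      case True
      then have "x ^ n \<ge> 1" using \<open>\<bar>x\<bar> > 1\<close> by simp
      then show ?thesis using True \<open>\<bar>x\<bar> > 1\<close> by simp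
    next
      case False
      then have y: "- x > 1" using \<open>\<bar>x\<bar> > 1\<close> by simp
      then have y1: "(- x) ^ n \<ge> 1" by simp
      show ?thesis
      proof (cases "even n")
        case True
        then show ?thesis using y y1 by simp
      next
        case False
        then show ?thesis using y y1 by simp
      qed
    qed
  qed
  moreover have "norm (1 - e ^ n) = \<bar>1 - x ^ n\<bar>"
    unfolding e by (metis norm_of_real of_real_1 of_real_diff of_real_power)
  ultimately have "complex_of_real (norm (1 - e ^ n)) = of_real
      ((if \<bar>x\<bar> > 1 then -1 else 1) * (if x < -1 then (-1) ^ n else 1) * (1 - x ^ n))" by simp
  also have "\<dots> = of_real (if \<bar>x\<bar> > 1 then -1 else 1) * of_real (if x < -1 then (-1) ^ n else 1)
      * (1 - e ^ n)" by (simp only: e of_real_mult of_real_diff of_real_1 of_real_power)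
  also have "complex_of_real (if \<bar>x\<bar> > 1 then -1 else 1) = (if norm e > 1 then -1 else 1)"
    by (simp add: e)
  also have "complex_of_real (if x < -1 then (-1) ^ n else 1) = (if Re e < -1 then (-1) ^ n else 1)"
    by (simp add: e)
  finally show ?thesis .
qed

text \<open>A conjugate pair of non-real elements contributes a number times its conjugate, hence a
  nonnegative real, and does not affect the sign.\<close>

lemma norm_prod_one_minus_power:
  fixes S :: "complex multiset"
  assumes S: "image_mset cnj S = S"
  defines "p \<equiv> size (filter_mset (\<lambda>\<mu>. \<mu> \<in> \<real> \<and> Re \<mu> < -1) S)"
    and "r \<equiv> size (filter_mset (\<lambda>\<mu>. \<mu> \<in> \<real> \<and> norm \<mu> > 1) S)"
  shows "of_real (norm (\<Prod>e\<in>#S. 1 - e ^ n)) = (-1) ^ (r + p * n) * (\<Prod>e\<in>#S. 1 - e ^ n)"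
proof -
  let ?f = "\<lambda>e :: complex. 1 - e ^ n"
  let ?pr = "\<lambda>S. \<Prod>e\<in>#S. ?f e"
  let ?R = "filter_mset (\<lambda>e. Im e = 0) S"
  let ?U = "filter_mset (\<lambda>e. Im e > 0) S"
  let ?L = "filter_mset (\<lambda>e. Im e < 0) S"
  have "filter_mset (\<lambda>e. Im e < 0) (image_mset cnj S) = image_mset cnj ?U"
    by (simp add: filter_mset_image_mset)
  then have L: "?L = image_mset cnj ?U" by (simp add: S)
  have split: "S = ?R + ?U + ?L" by (rule multiset_eqI) auto
  have "?pr ?L = cnj (?pr ?U)" unfolding L by (induction S) auto
  then have UL: "?pr ?U * ?pr ?L = of_real ((norm (?pr ?U))\<^sup>2)"
    by (metis complex_norm_square)
  \<comment> \<open>Each real element carries its own sign, so this part is proved by induction over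
    all multisets; conjugation invariance would not pass to smaller ones.\<close>
  have "of_real (norm (?pr ?R)) = (-1) ^ (r + p * n) * ?pr ?R"
    unfolding p_def r_def
  proof (induction S)
    case (add e S)
    show ?case
    proof (cases "Im e = 0")
      case True
      then have "e \<in> \<real>" by (simp add: complex_is_Real_iff)
      let ?r = "\<lambda>S. size (filter_mset (\<lambda>\<mu>. \<mu> \<in> \<real> \<and> norm \<mu> > 1) S)"
      let ?p = "\<lambda>S. size (filter_mset (\<lambda>\<mu>. \<mu> \<in> \<real> \<and> Re \<mu> < -1) S)"
      have sgn: "(-1 :: complex) ^ (?r (add_mset e S) + ?p (add_mset e S) * n) =
          (if norm e > 1 then -1 else 1) * (if Re e < -1 then (-1) ^ n else 1) *
          (-1) ^ (?r S + ?p S * n)"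
        using \<open>e \<in> \<real>\<close> by (simp add: power_add)
      have pr: "(\<Prod>e\<in>#filter_mset (\<lambda>e. Im e = 0) (add_mset e S). ?f e)
          = ?f e * (\<Prod>e\<in>#filter_mset (\<lambda>e. Im e = 0) S. ?f e)"
        using True by simp
      show ?thesis
        unfolding sgn pr norm_mult of_real_mult sign_real_factor[OF \<open>e \<in> \<real>\<close>] add.IH
        by (simp only: mult_ac)
    next
      case False
      then show ?thesis using add by (simp add: complex_is_Real_iff)
    qed
  qed auto
  moreover have pS: "?pr S = ?pr ?R * (?pr ?U * ?pr ?L)"
    by (subst split) (simp add: mult_ac)
  ultimately show ?thesis
    unfolding pS UL by (simp add: norm_mult norm_power)
qed

text \<open>The characteristic polynomial of an integer matrix has real coefficients, which supplies
  the conjugation invariance of the roots.\<close>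

lemma norm_det_one_minus_pow:
  fixes N :: "int mat"
  assumes N: "N \<in> carrier_mat k k"
  defines "M \<equiv> map_mat of_int N :: complex mat"
  defines "p \<equiv> num_eigs M (\<lambda>\<mu>. \<mu> \<in> \<real> \<and> Re \<mu> < -1)"
    and "r \<equiv> num_eigs M (\<lambda>\<mu>. \<mu> \<in> \<real> \<and> norm \<mu> > 1)"
  shows "of_real (norm (det (1\<^sub>m k - M ^\<^sub>m n))) = (-1) ^ (r + p * n) * det (1\<^sub>m k - M ^\<^sub>m n)"
proof -
  have M: "M \<in> carrier_mat k k" using N by (simp add: M_def)
  let ?q = "char_poly M"
  have "?q = map_poly of_int (char_poly N)"
    unfolding M_def by (rule of_int_hom.char_poly_hom[OF N])
  then have "map_poly cnj ?q = ?q" by (simp add: poly_eq_iff coeff_map_poly)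
  then have S: "image_mset cnj (proots ?q) = proots ?q" by (rule proots_cnj)
  obtain es where es: "length es = k" "?q = (\<Prod>e\<leftarrow>es. [:- e, 1:])"
    "\<And>x n. det (1\<^sub>m k - x \<cdot>\<^sub>m (M ^\<^sub>m n)) = (\<Prod>j<k. 1 - x * es ! j ^ n)"
    by (rule eigenvalue_list[OF M]) (rule that, assumption+)
  have roots: "proots ?q = mset es" unfolding es(2) by (rule proots_linear_factors)
  have "1 \<cdot>\<^sub>m (M ^\<^sub>m n) = M ^\<^sub>m n" by (intro eq_matI) auto
  then have "det (1\<^sub>m k - M ^\<^sub>m n) = (\<Prod>j<k. 1 - es ! j ^ n)"
    using es(3)[of 1 n] by simp
  also have "\<dots> = (\<Prod>e\<leftarrow>es. 1 - e ^ n)"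
    using es(1) by (simp add: prod.list_conv_set_nth atLeast0LessThan)
  also have "\<dots> = (\<Prod>e\<in>#proots ?q. 1 - e ^ n)"
    unfolding roots by (simp add: prod_mset_prod_list flip: mset_map)
  finally show ?thesis
    using norm_prod_one_minus_power[OF S, of n]
    unfolding p_def r_def num_eigs_eq_size[OF M] by simp
qed

section \<open>Index of subgroups\<close>

definition is_subgroup :: "'a::ab_group_add set \<Rightarrow> bool" where
  "is_subgroup A \<longleftrightarrow> 0 \<in> A \<and> (\<forall>x\<in>A. \<forall>y\<in>A. x - y \<in> A)"

lemma is_subgroupD:
  assumes "is_subgroup A"
  shows "0 \<in> A" "x \<in> A \<Longrightarrow> y \<in> A \<Longrightarrow> x - y \<in> A"
    "x \<in> A \<Longrightarrow> - x \<in> A" "x \<in> A \<Longrightarrow> y \<in> A \<Longrightarrow> x + y \<in> A"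
proof -
  show d: "0 \<in> A" "x \<in> A \<Longrightarrow> y \<in> A \<Longrightarrow> x - y \<in> A" for x y
    using assms by (auto simp: is_subgroup_def)
  show m: "x \<in> A \<Longrightarrow> - x \<in> A" for x using d(2)[of 0 x] d(1) by simp
  show "x \<in> A \<Longrightarrow> y \<in> A \<Longrightarrow> x + y \<in> A" using d(2)[of x "- y"] m[of y] by simp
qed

lemma is_subgroup_UNIV: "is_subgroup UNIV"
  by (simp add: is_subgroup_def)

lemma is_subgroup_0: "is_subgroup {0}"
  by (simp add: is_subgroup_def)

lemma is_subgroup_image:
  assumes "is_subgroup A" "Modules.additive c"
  shows "is_subgroup (c ` A)"
  unfolding is_subgroup_def
  using is_subgroupD[OF assms(1)] additive.zero[OF assms(2)] additive.diff[OF assms(2), symmetric]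
  by (auto intro!: image_eqI)

definition coset_index :: "'a::ab_group_add set \<Rightarrow> 'a set \<Rightarrow> nat" where
  "coset_index A H = card ((\<lambda>x. (+) x ` H) ` A)"

text \<open>Indices are computed with sets of representatives, which can be added and paired more
  easily than sets of cosets.\<close>

definition is_transversal :: "'a::ab_group_add set \<Rightarrow> 'a set \<Rightarrow> 'a set \<Rightarrow> bool" where
  "is_transversal A H T \<longleftrightarrow> T \<subseteq> A \<and> (\<forall>x\<in>A. \<exists>t\<in>T. x - t \<in> H) \<and>
     (\<forall>s\<in>T. \<forall>t\<in>T. s - t \<in> H \<longrightarrow> s = t)"

lemma coset_eq_iff:
  assumes H: "is_subgroup H"
  shows "(+) x ` H = (+) y ` H \<longleftrightarrow> x - y \<in> H"
proof
  assume "(+) x ` H = (+) y ` H"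
  moreover have "x \<in> (+) x ` H" using is_subgroupD(1)[OF H] by (force intro: image_eqI[of _ _ 0])
  ultimately obtain h where "h \<in> H" "x = y + h" by auto
  then show "x - y \<in> H" by simp
next
  assume xy: "x - y \<in> H"
  have "x + h \<in> (+) y ` H" if "h \<in> H" for h
    using is_subgroupD(4)[OF H xy that] by (intro image_eqI[of _ _ "x - y + h"]) auto
  moreover have "y + h \<in> (+) x ` H" if "h \<in> H" for h
    using is_subgroupD(2)[OF H that xy] by (intro image_eqI[of _ _ "h - (x - y)"]) auto
  ultimately show "(+) x ` H = (+) y ` H" by blast
qed

lemma is_transversal_exists:
  assumes H: "is_subgroup H"
  shows "\<exists>T. is_transversal A H T"
proof -
  let ?c = "\<lambda>x. (+) x ` H"
  define rep where "rep = inv_into A ?c"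
  have rep: "rep (?c x) \<in> A" "x - rep (?c x) \<in> H" if "x \<in> A" for x
  proof -
    show "rep (?c x) \<in> A" unfolding rep_def using that by (intro inv_into_into) auto
    have "?c (rep (?c x)) = ?c x" unfolding rep_def using that by (intro f_inv_into_f) auto
    then show "x - rep (?c x) \<in> H" using coset_eq_iff[OF H] by blast
  qed
  have "is_transversal A H (rep ` ?c ` A)"
    unfolding is_transversal_def
  proof (intro conjI ballI impI)
    fix s t assume "s \<in> rep ` ?c ` A" "t \<in> rep ` ?c ` A" and st: "s - t \<in> H"
    then obtain x y where x: "x \<in> A" "s = rep (?c x)" and y: "y \<in> A" "t = rep (?c y)" by auto
    have "?c x = ?c s" "?c y = ?c t" "?c s = ?c t"
      using rep[OF x(1)] rep[OF y(1)] x y st coset_eq_iff[OF H] by simp_all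
    then show "s = t" using x y by simp
  qed (use rep in auto)
  then show ?thesis by blast
qed

lemma coset_index_eq_card_transversal:
  assumes H: "is_subgroup H" and T: "is_transversal A H T"
  shows "coset_index A H = card T"
proof -
  let ?c = "\<lambda>x. (+) x ` H"
  have "?c ` A = ?c ` T"
  proof (intro equalityI subsetI)
    fix C assume "C \<in> ?c ` A"
    then obtain x where x: "x \<in> A" "C = ?c x" by auto
    then obtain t where "t \<in> T" "x - t \<in> H" using T by (auto simp: is_transversal_def)
    then show "C \<in> ?c ` T" using x coset_eq_iff[OF H, of x t] by (intro image_eqI[of _ _ t]) simp_all
  qed (use T in \<open>auto simp: is_transversal_def\<close>)
  moreover have "inj_on ?c T"
    using T coset_eq_iff[OF H] unfolding is_transversal_def inj_on_def by simp
  ultimately show ?thesis by (simp add: coset_index_def card_image)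
qed

text \<open>Both lemmas below hold without finiteness assumptions, because an infinite index is
  recorded as 0 and \<open>card (A \<times> B) = card A * card B\<close> is valid for arbitrary sets.\<close>

lemma coset_index_hom:
  assumes A: "is_subgroup A" and H: "is_subgroup H" and HA: "H \<subseteq> A" and c: "Modules.additive c"
  shows "coset_index A H =
    coset_index (c ` A) (c ` H) * coset_index {x \<in> A. c x = 0} {x \<in> H. c x = 0}"
proof -
  let ?K = "{x \<in> A. c x = 0}" and ?L = "{x \<in> H. c x = 0}"
  note c0 = additive.zero[OF c] and cd = additive.diff[OF c] and ca = additive.add[OF c]
  have L: "is_subgroup ?L" using is_subgroupD[OF H] by (auto simp: is_subgroup_def c0 cd)
  have cH: "is_subgroup (c ` H)" by (rule is_subgroup_image[OF H c])
  obtain T where T: "is_transversal (c ` A) (c ` H) T" using is_transversal_exists[OF cH] by blast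
  obtain S where S: "is_transversal ?K ?L S" using is_transversal_exists[OF L] by blast
  define l where "l = inv_into A c"
  have l: "l t \<in> A" "c (l t) = t" if "t \<in> T" for t
    using that T by (auto simp: l_def is_transversal_def intro: inv_into_into f_inv_into_f)
  have SK: "s \<in> A" "c s = 0" if "s \<in> S" for s
    using that S by (auto simp: is_transversal_def)
  \<comment> \<open>Lifts of representatives of the image, shifted by representatives of the kernel
    part, represent each coset of H in A once.\<close>
  let ?f = "\<lambda>(t, s). l t + s"
  have uniq: "t = t' \<and> s = s'"
    if "t \<in> T" "s \<in> S" "t' \<in> T" "s' \<in> S" and d: "l t + s - (l t' + s') \<in> H" for t s t' s'
  proof -
    have "c (l t + s - (l t' + s')) = t - t'" using l SK that by (simp add: cd ca)
    then have "t - t' \<in> c ` H" using d by (metis imageI)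
    then have t: "t = t'" using T that by (auto simp: is_transversal_def)
    then have "s - s' \<in> ?L" using d SK that by (simp add: cd)
    then have "s = s'" using S that unfolding is_transversal_def by blast
    with t show ?thesis by simp
  qed
  have "is_transversal A H (?f ` (T \<times> S))"
    unfolding is_transversal_def
  proof (intro conjI ballI impI)
    show "?f ` (T \<times> S) \<subseteq> A" using l SK is_subgroupD(4)[OF A] by auto
  next
    fix x assume x: "x \<in> A"
    then obtain t where t: "t \<in> T" "c x - t \<in> c ` H" using T by (auto simp: is_transversal_def)
    then obtain h where h: "h \<in> H" "c x - t = c h" by auto
    have "x - l t - h \<in> ?K"
      using x h l[OF t(1)] HA is_subgroupD[OF A] by (auto simp: cd)
    then obtain s where s: "s \<in> S" "x - l t - h - s \<in> ?L"
      using S unfolding is_transversal_def by blast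
    then have "x - l t - h - s + h \<in> H" using is_subgroupD(4)[OF H] h by blast
    then have "x - ?f (t, s) \<in> H" by (simp add: algebra_simps)
    then show "\<exists>y\<in>?f ` (T \<times> S). x - y \<in> H" using t s by blast
  next
    fix x y assume "x \<in> ?f ` (T \<times> S)" "y \<in> ?f ` (T \<times> S)" "x - y \<in> H"
    then show "x = y" using uniq by auto
  qed
  then have "coset_index A H = card (?f ` (T \<times> S))"
    by (rule coset_index_eq_card_transversal[OF H])
  also have "inj_on ?f (T \<times> S)"
  proof (rule inj_onI, clarify)
    fix t s t' s' assume "t \<in> T" "s \<in> S" "t' \<in> T" "s' \<in> S" "l t + s = l t' + s'"
    then show "t = t' \<and> s = s'" using uniq[of t s t' s'] is_subgroupD(1)[OF H] by simp
  qed
  then have "card (?f ` (T \<times> S)) = card T * card S"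
    by (simp add: card_image card_cartesian_product)
  finally show ?thesis
    by (simp add: coset_index_eq_card_transversal[OF cH T] coset_index_eq_card_transversal[OF L S])
qed

lemma card_eq_coset_index_mult:
  assumes A: "is_subgroup A" and H: "is_subgroup H" and HA: "H \<subseteq> A"
  shows "card A = coset_index A H * card H"
proof -
  obtain T where T: "is_transversal A H T" using is_transversal_exists[OF H] by blast
  let ?f = "\<lambda>(t, h). t + h"
  have "?f ` (T \<times> H) = A"
  proof (intro equalityI subsetI)
    fix x assume "x \<in> A"
    then obtain t where "t \<in> T" "x - t \<in> H" using T by (auto simp: is_transversal_def)
    then show "x \<in> ?f ` (T \<times> H)" by (intro image_eqI[of _ _ "(t, x - t)"]) auto
  qed (use T HA is_subgroupD(4)[OF A] in \<open>auto simp: is_transversal_def\<close>)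
  moreover have "inj_on ?f (T \<times> H)"
  proof (rule inj_onI, clarify)
    fix t s h g assume *: "t \<in> T" "s \<in> T" "h \<in> H" "g \<in> H" "t + h = s + g"
    then have "t - s = g - h" by (simp add: algebra_simps)
    then have "t - s \<in> H" using * is_subgroupD(2)[OF H] by simp
    then have "t = s" using T * by (auto simp: is_transversal_def)
    then show "t = s \<and> h = g" using * by simp
  qed
  ultimately have "card A = card (T \<times> H)" by (metis card_image)
  then show ?thesis
    by (simp add: card_cartesian_product coset_index_eq_card_transversal[OF H T])
qed

text \<open>The order of A is [A : hA] times the order of hA, and also the order of hA times that of
  the kernel. Finiteness permits cancelling the order of hA.\<close>

lemma coset_index_image_self:
  assumes A: "is_subgroup A" and fin: "finite A" and h: "Modules.additive h" and hA: "h ` A \<subseteq> A"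
  shows "coset_index A (h ` A) = card {x \<in> A. h x = 0}"
proof -
  note sub = is_subgroup_image[OF A h]
  have i0: "coset_index B {0} = card B" for B :: "'a set"
    unfolding coset_index_def by (subst card_image) (auto simp: inj_on_def)
  have "coset_index A {0} = coset_index (h ` A) (h ` {0}) *
      coset_index {x \<in> A. h x = 0} {x \<in> {0}. h x = 0}"
    using is_subgroupD(1)[OF A] by (intro coset_index_hom[OF A is_subgroup_0 _ h]) auto
  also have "{x \<in> {0}. h x = 0} = {0}" using additive.zero[OF h] by auto
  finally have "card A = card (h ` A) * card {x \<in> A. h x = 0}"
    using additive.zero[OF h] by (simp add: i0)
  moreover have "card A = coset_index A (h ` A) * card (h ` A)"
    by (rule card_eq_coset_index_mult[OF A sub hA])
  moreover have "card (h ` A) > 0" using fin is_subgroupD(1)[OF A] by (auto simp: card_gt_0_iff)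
  ultimately show ?thesis by simp
qed

section \<open>The index of the image of an integer matrix\<close>

text \<open>Here \<open>\<int>\<^sup>k\<close> is the group of functions \<open>nat \<Rightarrow> int\<close> that vanish from index \<open>k\<close> on.\<close>

definition int_vecs :: "nat \<Rightarrow> (nat \<Rightarrow> int) set" where
  "int_vecs k = {v. \<forall>i\<ge>k. v i = 0}"

definition mat_app :: "nat \<Rightarrow> int mat \<Rightarrow> (nat \<Rightarrow> int) \<Rightarrow> nat \<Rightarrow> int" where
  "mat_app k M v = (\<lambda>i. if i < k then \<Sum>j<k. M $$ (i, j) * v j else 0)"

lemma is_subgroup_int_vecs: "is_subgroup (int_vecs k)"
  by (auto simp: is_subgroup_def int_vecs_def)

lemma additive_mat_app: "Modules.additive (mat_app k M)"
  by (rule additive.intro) (auto simp: mat_app_def fun_eq_iff algebra_simps sum.distrib)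

lemma mat_app_in: "mat_app k M v \<in> int_vecs k"
  by (simp add: mat_app_def int_vecs_def)

lemma mat_app_addcol_image:
  assumes M: "M \<in> carrier_mat n n" and pq: "p < n" "q < n" "p \<noteq> q"
  shows "mat_app n (addcol a p q M) ` int_vecs n = mat_app n M ` int_vecs n"
proof -
  have sub: "mat_app n (addcol a p q M) ` int_vecs n \<subseteq> mat_app n M ` int_vecs n"
    if M: "M \<in> carrier_mat n n" for a and M :: "int mat"
  proof (intro image_subsetI)
    fix v :: "nat \<Rightarrow> int" assume v: "v \<in> int_vecs n"
    \<comment> \<open>Adding a times column q to column p has the same effect as this shear of the
      argument.\<close>
    let ?w = "v(q := v q + a * v p)"
    have "mat_app n (addcol a p q M) v = mat_app n M ?w"
    proof
      fix i show "mat_app n (addcol a p q M) v i = mat_app n M ?w i"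
      proof (cases "i < n")
        case True
        have "(\<Sum>j<n. addcol a p q M $$ (i, j) * v j)
            = (\<Sum>j<n. M $$ (i, j) * v j + (if j = p then a * M $$ (i, q) * v p else 0))"
          using M True by (intro sum.cong) (auto simp: algebra_simps)
        also have "\<dots> = (\<Sum>j<n. M $$ (i, j) * v j) + a * M $$ (i, q) * v p"
          using pq by (simp add: sum.distrib)
        also have "\<dots> = (\<Sum>j<n. M $$ (i, j) * v j + (if j = q then a * M $$ (i, q) * v p else 0))"
          using pq by (simp add: sum.distrib)
        also have "\<dots> = (\<Sum>j<n. M $$ (i, j) * ?w j)"
          by (intro sum.cong) (auto simp: algebra_simps)
        finally show ?thesis using True by (simp add: mat_app_def)
      qed (simp add: mat_app_def)
    qed
    moreover have "?w \<in> int_vecs n" using v pq by (auto simp: int_vecs_def)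
    ultimately show "mat_app n (addcol a p q M) v \<in> mat_app n M ` int_vecs n" by blast
  qed
  \<comment> \<open>The operation is undone by one of the same kind, so the first inclusion also
    gives the reverse one.\<close>
  have "addcol (- a) p q (addcol a p q M) = M"
    using M pq by (intro eq_matI) auto
  moreover have "addcol a p q M \<in> carrier_mat n n" using M by auto
  ultimately have "mat_app n M ` int_vecs n \<subseteq> mat_app n (addcol a p q M) ` int_vecs n"
    using sub[of "addcol a p q M" "- a"] by simp
  with sub[OF M] show ?thesis by blast
qed

lemma sum_less_if_one_less:
  fixes f g :: "nat \<Rightarrow> nat"
  assumes "p < n" "f p < g p" "\<And>j. j < n \<Longrightarrow> j \<noteq> p \<Longrightarrow> f j = g j"
  shows "(\<Sum>j<n. f j) < (\<Sum>j<n. g j)"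
proof (rule sum_strict_mono_ex1)
  show "\<forall>j\<in>{..<n}. f j \<le> g j"
  proof
    fix j assume "j \<in> {..<n}"
    then show "f j \<le> g j" using assms by (cases "j = p") auto
  qed
qed (use assms in auto)

text \<open>The Euclidean algorithm by column operations on the last row.\<close>

lemma column_reduce_last_row:
  fixes M :: "int mat"
  assumes "M \<in> carrier_mat (Suc k) (Suc k)"
  shows "\<exists>N. N \<in> carrier_mat (Suc k) (Suc k) \<and> det N = det M \<and>
    mat_app (Suc k) N ` int_vecs (Suc k) = mat_app (Suc k) M ` int_vecs (Suc k) \<and>
    (\<forall>j<k. N $$ (k, j) = 0)"
  using assms
proof (induction "\<Sum>j<Suc k. nat \<bar>M $$ (k, j)\<bar>" arbitrary: M rule: less_induct)
  case less
  let ?n = "Suc k"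
  note M = less.prems
  show ?case
  proof (cases "\<exists>p q. p < ?n \<and> q < ?n \<and> p \<noteq> q \<and> M $$ (k, p) \<noteq> 0 \<and> M $$ (k, q) \<noteq> 0")
    case True
    then have "\<exists>p q. p < ?n \<and> q < ?n \<and> p \<noteq> q \<and> M $$ (k, p) \<noteq> 0 \<and> M $$ (k, q) \<noteq> 0 \<and>
        \<bar>M $$ (k, q)\<bar> \<le> \<bar>M $$ (k, p)\<bar>" by (metis nle_le)
    then obtain p q where pq: "p < ?n" "q < ?n" "p \<noteq> q" "M $$ (k, p) \<noteq> 0" "M $$ (k, q) \<noteq> 0"
      "\<bar>M $$ (k, q)\<bar> \<le> \<bar>M $$ (k, p)\<bar>" by blast
    \<comment> \<open>With this sign and \<bar>M $$ (k, q)\<bar> \<le> \<bar>M $$ (k, p)\<bar>, the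
      absolute value at p drops by that at q, so the measure decreases.\<close>
    define a where "a = - (sgn (M $$ (k, p)) * sgn (M $$ (k, q)))"
    let ?M = "addcol a p q M"
    have M': "?M \<in> carrier_mat ?n ?n" using M by auto
    have "\<bar>a * M $$ (k, q) + M $$ (k, p)\<bar> < \<bar>M $$ (k, p)\<bar>"
      using pq by (cases "M $$ (k, p)" "0 :: int" rule: linorder_cases;
          cases "M $$ (k, q)" "0 :: int" rule: linorder_cases) (auto simp: a_def)
    then have lt: "nat \<bar>?M $$ (k, p)\<bar> < nat \<bar>M $$ (k, p)\<bar>" using M pq by simp
    have eq: "nat \<bar>?M $$ (k, j)\<bar> = nat \<bar>M $$ (k, j)\<bar>" if "j < ?n" "j \<noteq> p" for j
      using M that by simp
    have "(\<Sum>j<?n. nat \<bar>?M $$ (k, j)\<bar>) < (\<Sum>j<?n. nat \<bar>M $$ (k, j)\<bar>)"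
      by (rule sum_less_if_one_less[OF pq(1)]) (use lt eq in blast)+
    from less.hyps[OF this M'] show ?thesis
      using mat_app_addcol_image[OF M pq(1-3)] det_addcol[OF pq(2,3) M] by simp
  next
    case False
    show ?thesis
    proof (cases "\<exists>p<k. M $$ (k, p) \<noteq> 0")
      case True
      then obtain p where p: "p < k" "M $$ (k, p) \<noteq> 0" by blast
      have z: "M $$ (k, j) = 0" if "j < ?n" "j \<noteq> p" for j
        using False p that by (metis less_SucI)
      \<comment> \<open>The only nonzero entry of the last row moves from column p to column k by
        two additions; a column swap would change the sign of the determinant.\<close>
      let ?M1 = "addcol 1 k p M"
      let ?M2 = "addcol (-1) p k ?M1"
      have M1: "?M1 \<in> carrier_mat ?n ?n" and M2: "?M2 \<in> carrier_mat ?n ?n" using M by auto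
      have "det ?M2 = det M"
        using det_addcol[of k ?n p ?M1 "-1"] det_addcol[of p ?n k M 1] p M M1 by simp
      moreover have "mat_app ?n ?M2 ` int_vecs ?n = mat_app ?n M ` int_vecs ?n"
        using mat_app_addcol_image[OF M1, of p k "-1"] mat_app_addcol_image[OF M, of k p 1] p by simp
      moreover have "?M2 $$ (k, j) = 0" if "j < k" for j
        using that p z M by auto
      ultimately show ?thesis using M2 by blast
    qed (use M in blast)
  qed
qed

lemma coset_index_int: "coset_index UNIV (range (\<lambda>x :: int. d * x)) = nat \<bar>d\<bar>"
proof -
  let ?H = "range (\<lambda>x. d * x)"
  have H: "y \<in> ?H \<longleftrightarrow> d dvd y" for y by auto
  have sub: "is_subgroup ?H" unfolding is_subgroup_def H by auto
  show ?thesis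
  proof (cases "d = 0")
    case True
    \<comment> \<open>The subgroup is 0 and its index infinite, which \<open>card\<close> records as
      0.\<close>
    then have "is_transversal UNIV ?H UNIV" by (auto simp: is_transversal_def)
    then show ?thesis using coset_index_eq_card_transversal[OF sub] True by simp
  next
    case False
    have "is_transversal UNIV ?H {0..<\<bar>d\<bar>}"
      unfolding is_transversal_def H
    proof (intro conjI ballI impI)
      fix x :: int
      have "d dvd x - x mod \<bar>d\<bar>" by (metis abs_dvd_iff dvd_minus_mod)
      then show "\<exists>t\<in>{0..<\<bar>d\<bar>}. d dvd x - t" using False by (intro bexI[of _ "x mod \<bar>d\<bar>"]) auto
    next
      fix s t :: int assume "s \<in> {0..<\<bar>d\<bar>}" "t \<in> {0..<\<bar>d\<bar>}" "d dvd s - t"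
      then show "s = t"
        by (metis abs_dvd_iff atLeastLessThan_iff mod_eq_dvd_iff mod_pos_pos_trivial)
    qed auto
    then show ?thesis using coset_index_eq_card_transversal[OF sub] by simp
  qed
qed

text \<open>Once the last row is (0, ..., 0, d), projection to the last coordinate splits the index
  into that of d in the integers and that of the leading block. Laplace expansion splits the
  determinant in the same way. A singular matrix has infinite index, again recorded as 0.\<close>

theorem coset_index_mat_app:
  fixes M :: "int mat"
  assumes "M \<in> carrier_mat k k"
  shows "coset_index (int_vecs k) (mat_app k M ` int_vecs k) = nat \<bar>det M\<bar>"
  using assms
proof (induction k arbitrary: M)
  case 0
  have "int_vecs 0 = {0}" by (auto simp: int_vecs_def fun_eq_iff)
  then show ?case using 0 by (simp add: coset_index_def)
next
  case (Suc k)
  let ?n = "Suc k"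
  obtain N where N: "N \<in> carrier_mat ?n ?n" "det N = det M"
    "mat_app ?n N ` int_vecs ?n = mat_app ?n M ` int_vecs ?n" "\<And>j. j < k \<Longrightarrow> N $$ (k, j) = 0"
    using column_reduce_last_row[OF Suc.prems] by blast
  define d where "d = N $$ (k, k)"
  define N' where "N' = mat k k (\<lambda>(i, j). N $$ (i, j))"
  have N': "N' \<in> carrier_mat k k" by (simp add: N'_def)
  have det: "det N = d * det N'"
  proof -
    have "mat_delete N k k = N'" using N(1) by (intro eq_matI) (auto simp: mat_delete_def N'_def)
    then have "cofactor N k k = det N'" by (simp add: cofactor_def flip: power_add mult_2)
    moreover have "det N = (\<Sum>j<?n. N $$ (k, j) * cofactor N k j)"
      by (rule laplace_expansion_row[OF N(1)]) simp
    moreover have "\<dots> = d * cofactor N k k" using N(4) by (simp add: d_def)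
    ultimately show ?thesis by simp
  qed
  let ?H = "mat_app ?n N ` int_vecs ?n"
  let ?c = "\<lambda>v :: nat \<Rightarrow> int. v k"
  have c: "Modules.additive ?c" by (rule additive.intro) simp
  have HS: "is_subgroup ?H" by (rule is_subgroup_image[OF is_subgroup_int_vecs additive_mat_app])
  have last: "mat_app ?n N v k = d * v k" for v using N(4) by (simp add: mat_app_def d_def)
  have surj: "?c ` int_vecs ?n = UNIV"
  proof -
    have "(\<lambda>i. if i = k then y else 0) \<in> int_vecs ?n" for y by (auto simp: int_vecs_def)
    then show ?thesis by (auto intro!: image_eqI[of _ ?c "\<lambda>i. if i = k then _ else 0"])
  qed
  have "?c ` ?H = (\<lambda>x. d * x) ` ?c ` int_vecs ?n" by (simp add: image_image last)
  then have cH: "?c ` ?H = range (\<lambda>x. d * x)" by (simp add: surj)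
  have K: "{v \<in> int_vecs ?n. v k = 0} = int_vecs k"
    by (auto simp: int_vecs_def le_Suc_eq Suc_le_eq) (metis le_neq_implies_less)
  have "coset_index (int_vecs ?n) ?H
      = nat \<bar>d\<bar> * coset_index (int_vecs k) {v \<in> ?H. v k = 0}"
    using coset_index_hom[OF is_subgroup_int_vecs HS _ c] mat_app_in
    by (simp add: surj cH coset_index_int K image_subset_iff)
  also have "\<dots> = nat \<bar>d\<bar> * nat \<bar>det N'\<bar>"
  proof (cases "d = 0")
    case False
    have eq: "mat_app ?n N v = mat_app k N' v" if "v k = 0" for v
      using N(4) that by (auto simp: mat_app_def N'_def fun_eq_iff less_Suc_eq)
    \<comment> \<open>As d is nonzero, the last coordinate d * v k of an image vanishes only if v k
      does, where N acts as its leading block.\<close>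
    have "{v \<in> ?H. v k = 0} = mat_app ?n N ` {v \<in> int_vecs ?n. v k = 0}"
      using False by (auto simp: last)
    also have "\<dots> = mat_app k N' ` int_vecs k"
      unfolding K[symmetric] by (rule image_cong) (auto intro: eq)
    finally show ?thesis using Suc.IH[OF N'] by simp
  qed simp
  finally show ?case using N(2,3) det by (simp flip: nat_mult_distrib abs_mult)
qed

section \<open>Integer multiples\<close>

lemma nmul_add: "nmul (m + n) x = nmul m x + nmul n x"
  by (induction m) (auto simp: add.assoc)

text \<open>Integers written as differences of naturals let \<open>zmul_add_left\<close> follow from
  \<open>nmul_add\<close> without a case split on signs.\<close>

lemma zmul_int_diff: "zmul (int m - int n) x = nmul m x - nmul n x"
proof (cases "n \<le> m")
  case True
  then have "nmul m x = nmul (m - n) x + nmul n x" by (simp flip: nmul_add)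
  moreover have "nat (int m - int n) = m - n" using True by simp
  ultimately show ?thesis using True by (simp add: zmul_def)
next
  case False
  then have "nmul n x = nmul (n - m) x + nmul m x" by (simp flip: nmul_add)
  moreover have "nat (- (int m - int n)) = n - m" using False by simp
  ultimately show ?thesis using False by (simp add: zmul_def)
qed

lemma zmul_of_nat: "zmul (int n) x = nmul n x"
  by (simp add: zmul_def)

lemma zmul_0_left [simp]: "zmul 0 x = 0"
  by (simp add: zmul_def)

lemma zmul_add_left: "zmul (a + b) x = zmul a x + zmul b x"
proof -
  obtain m n where a: "a = int m - int n" by (rule int_diff_cases)
  obtain m' n' where b: "b = int m' - int n'" by (rule int_diff_cases)
  have "a + b = int (m + m') - int (n + n')" by (simp add: a b)
  then have "zmul (a + b) x = nmul (m + m') x - nmul (n + n') x" by (simp only: zmul_int_diff)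
  then show ?thesis unfolding a b zmul_int_diff by (simp add: nmul_add)
qed

lemma zmul_minus_left: "zmul (- a) x = - zmul a x"
  using zmul_add_left[of "- a" a x] by (simp add: eq_neg_iff_add_eq_0)

lemma zmul_diff_left: "zmul (a - b) x = zmul a x - zmul b x"
  using zmul_add_left[of a "- b" x] by (simp add: zmul_minus_left)

lemma additive_nmul:
  assumes "Modules.additive f"
  shows "f (nmul n x) = nmul n (f x)"
  by (induction n) (auto simp: additive.zero[OF assms] additive.add[OF assms])

lemma additive_zmul:
  assumes "Modules.additive f"
  shows "f (zmul a x) = zmul a (f x)"
  by (simp add: zmul_def additive_nmul[OF assms] additive.minus[OF assms])

lemma additive_zmul_right: "Modules.additive (zmul a)"
proof
  have "nmul n (x + y) = nmul n x + nmul n y" for n and x y :: 'a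
    by (induction n) (auto simp: algebra_simps)
  then show "zmul a (x + y) = zmul a x + zmul a y" for x y :: 'a by (simp add: zmul_def)
qed

lemmas zmul_add_right = additive.add[OF additive_zmul_right]
  and zmul_diff_right = additive.diff[OF additive_zmul_right]
  and zmul_0_right [simp] = additive.zero[OF additive_zmul_right]

lemma zmul_mult: "zmul (a * b) x = zmul a (zmul b x)"
proof -
  have "nmul (m * n) x = nmul m (nmul n x)" for m n by (induction m) (auto simp: nmul_add)
  then have *: "zmul (int m * b) x = nmul m (zmul b x)" for m
    by (induction m) (auto simp: zmul_add_left distrib_right)
  show ?thesis
  proof (cases "a \<ge> 0")
    case True
    then show ?thesis using *[of "nat a"] by (simp add: zmul_def[of a])
  next
    case False
    then have "zmul (a * b) x = - zmul (int (nat (- a)) * b) x" by (simp flip: zmul_minus_left)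
    then show ?thesis using *[of "nat (- a)"] False by (simp add: zmul_def[of a])
  qed
qed

lemma zmul_int [simp]: "zmul a (y :: int) = a * y"
proof -
  have "nmul n y = int n * y" for n by (induction n) (auto simp: algebra_simps)
  then show ?thesis by (auto simp: zmul_def)
qed

lemma torsion_iff: "x \<in> torsion \<longleftrightarrow> (\<exists>a\<noteq>0. zmul a x = 0)"
proof
  assume "x \<in> torsion"
  then obtain n where "n > 0" "nmul n x = 0" by (auto simp: torsion_def)
  then show "\<exists>a\<noteq>0. zmul a x = 0" by (intro exI[of _ "int n"]) (simp add: zmul_of_nat)
next
  assume "\<exists>a\<noteq>0. zmul a x = 0"
  then obtain a where "a \<noteq> 0" "zmul a x = 0" by blast
  then have "nat \<bar>a\<bar> > 0 \<and> nmul (nat \<bar>a\<bar>) x = 0"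
    by (cases "a \<ge> 0") (auto simp: zmul_def)
  then show "x \<in> torsion" unfolding torsion_def by blast
qed

lemma is_subgroup_torsion: "is_subgroup (torsion :: 'g::ab_group_add set)"
proof -
  have "x - y \<in> torsion" if xy: "x \<in> torsion" "y \<in> torsion" for x y :: 'g
  proof -
    obtain a b where a: "a \<noteq> 0" "zmul a x = 0" and b: "b \<noteq> 0" "zmul b y = 0"
      using xy by (auto simp: torsion_iff)
    have "zmul (a * b) x = zmul b (zmul a x)" by (simp add: mult.commute flip: zmul_mult)
    then have "zmul (a * b) (x - y) = 0" using a b by (simp add: zmul_diff_right zmul_mult)
    then show ?thesis using a b unfolding torsion_iff by (intro exI[of _ "a * b"]) auto
  qed
  moreover have "(0 :: 'g) \<in> torsion" unfolding torsion_iff by (intro exI[of _ 1]) auto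
  ultimately show ?thesis by (auto simp: is_subgroup_def)
qed

lemma torsion_hom: "Modules.additive f \<Longrightarrow> x \<in> torsion \<Longrightarrow> f x \<in> torsion"
  unfolding torsion_iff by (metis additive_zmul additive.zero)

lemma torsion_zmul_cancel:
  assumes "zmul a x \<in> torsion" "a \<noteq> 0"
  shows "x \<in> torsion"
proof -
  obtain b where "b \<noteq> 0" "zmul b (zmul a x) = 0" using assms(1) by (auto simp: torsion_iff)
  then show ?thesis
    using assms(2) unfolding torsion_iff zmul_mult[symmetric] by (intro exI[of _ "b * a"]) auto
qed

lemma torsion_zmul: "x \<in> torsion \<Longrightarrow> zmul a x \<in> torsion"
  by (rule torsion_hom[OF additive_zmul_right])

lemma torsion_int_vecs: "(v :: nat \<Rightarrow> int) \<in> torsion \<Longrightarrow> v = 0"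
proof
  fix i assume "v \<in> torsion"
  moreover have "Modules.additive (\<lambda>v :: nat \<Rightarrow> int. v i)" by (rule additive.intro) simp
  ultimately have "v i \<in> torsion" by (rule torsion_hom[rotated])
  then show "v i = 0 i" by (auto simp: torsion_iff)
qed

section \<open>A basis modulo torsion\<close>

text \<open>Functions replace the lists of \<open>lincomb\<close>, so that single entries can be
  updated and coefficients added pointwise.\<close>

definition lin :: "(nat \<Rightarrow> int) \<Rightarrow> (nat \<Rightarrow> 'g::ab_group_add) \<Rightarrow> nat \<Rightarrow> 'g" where
  "lin c g n = (\<Sum>j<n. zmul (c j) (g j))"

lemma lin_cong:
  "(\<And>j. j < n \<Longrightarrow> c j = d j) \<Longrightarrow> (\<And>j. j < n \<Longrightarrow> g j = h j) \<Longrightarrow> lin c g n = lin d h n"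
  by (simp add: lin_def)

lemma lincomb_eq_lin: "lincomb cs bs = lin ((!) cs) ((!) bs) (length bs)"
  by (simp add: lincomb_def lin_def)

lemma lin_diff_left: "lin (\<lambda>j. c j - d j) g n = lin c g n - lin d g n"
  by (simp add: lin_def zmul_diff_left sum_subtractf)

lemma lin_add_left: "lin (\<lambda>j. c j + d j) g n = lin c g n + lin d g n"
  by (simp add: lin_def zmul_add_left sum.distrib)

lemma additive_lin: "Modules.additive f \<Longrightarrow> f (lin c g n) = lin c (\<lambda>j. f (g j)) n"
  by (simp add: lin_def additive.sum additive_zmul)

definition spans :: "(nat \<Rightarrow> 'g::ab_group_add) \<Rightarrow> nat \<Rightarrow> bool" where
  "spans g n \<longleftrightarrow> (\<forall>x. \<exists>c. x - lin c g n \<in> torsion)"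

text \<open>A change of generators compensated in the coefficients. It lets a Euclidean step act on
  a relation without changing its value or what the generators span.\<close>

lemma lin_update:
  assumes "p < n" "q < n" "p \<noteq> q"
  shows "lin (c(p := c p - e * c q)) (g(q := g q + zmul e (g p))) n = lin c g n"
proof -
  let ?c = "c(p := c p - e * c q)" and ?g = "g(q := g q + zmul e (g p))"
  have split: "(\<Sum>j<n. f j) = f p + (f q + (\<Sum>j\<in>{..<n} - {p} - {q}. f j))" for f :: "nat \<Rightarrow> 'a"
    using assms by (simp add: sum.remove[of _ p] sum.remove[of _ q])
  have "(\<Sum>j\<in>{..<n} - {p} - {q}. zmul (?c j) (?g j)) = (\<Sum>j\<in>{..<n} - {p} - {q}. zmul (c j) (g j))"
    by (intro sum.cong) auto
  moreover have "zmul (c q) (zmul e (g p)) = zmul (e * c q) (g p)"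
    by (simp add: mult.commute flip: zmul_mult)
  ultimately show ?thesis
    unfolding lin_def split using assms
    by (simp add: zmul_diff_left zmul_add_right)
qed

text \<open>A nontrivial relation is transformed by the Euclidean algorithm until it involves a single
  generator, which is then torsion and can be dropped.\<close>

lemma spans_reduce:
  fixes g :: "nat \<Rightarrow> 'g::ab_group_add"
  assumes "spans g n" "lin c g n \<in> torsion" "\<exists>j<n. c j \<noteq> 0"
  shows "\<exists>h :: nat \<Rightarrow> 'g. spans h (n - 1)"
  using assms
proof (induction "\<Sum>j<n. nat \<bar>c j\<bar>" arbitrary: c g rule: less_induct)
  case less
  show ?case
  proof (cases "\<exists>p q. p < n \<and> q < n \<and> p \<noteq> q \<and> c p \<noteq> 0 \<and> c q \<noteq> 0")
    case True
    then have "\<exists>p q. p < n \<and> q < n \<and> p \<noteq> q \<and> c p \<noteq> 0 \<and> c q \<noteq> 0 \<and> \<bar>c q\<bar> \<le> \<bar>c p\<bar>"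
      by (metis nle_le)
    then obtain p q where pq: "p < n" "q < n" "p \<noteq> q" "c p \<noteq> 0" "c q \<noteq> 0" "\<bar>c q\<bar> \<le> \<bar>c p\<bar>"
      by blast
    \<comment> \<open>With this sign \<bar>c p\<bar> drops by \<bar>c q\<bar>, while c q stays
      nonzero and keeps the relation nontrivial.\<close>
    define e where "e = sgn (c p) * sgn (c q)"
    let ?c = "\<lambda>c. c(p := c p - e * c q)" and ?g = "g(q := g q + zmul e (g p))"
    have lin: "lin (?c d) ?g n = lin d g n" for d by (rule lin_update[OF pq(1-3)])
    have "\<bar>c p - e * c q\<bar> < \<bar>c p\<bar>"
      using pq by (cases "c p" "0 :: int" rule: linorder_cases;
          cases "c q" "0 :: int" rule: linorder_cases) (auto simp: e_def)
    then have lt: "(\<Sum>j<n. nat \<bar>?c c j\<bar>) < (\<Sum>j<n. nat \<bar>c j\<bar>)"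
      using pq by (intro sum_less_if_one_less[OF pq(1)]) auto
    have "spans ?g n" unfolding spans_def
    proof
      fix x obtain d where "x - lin d g n \<in> torsion" using less.prems(1) by (auto simp: spans_def)
      then show "\<exists>d. x - lin d ?g n \<in> torsion" unfolding lin[symmetric] by blast
    qed
    moreover have "lin (?c c) ?g n \<in> torsion" using less.prems(2) by (simp only: lin)
    moreover have "\<exists>j<n. ?c c j \<noteq> 0" using pq by (intro exI[of _ q]) auto
    ultimately show ?thesis by (rule less.hyps[OF lt])
  next
    case False
    obtain p where p: "p < n" "c p \<noteq> 0" using less.prems(3) by blast
    have "c j = 0" if "j < n" "j \<noteq> p" for j using False p that by blast
    then have "lin c g n = zmul (c p) (g p)"
      unfolding lin_def using p by (subst sum.remove[of _ p]) (auto intro!: sum.neutral)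
    then have gp: "g p \<in> torsion" using less.prems(2) p torsion_zmul_cancel by metis
    \<comment> \<open>The last generator takes the slot of the torsion one, so that the remaining
      generators are those below n - 1.\<close>
    let ?h = "g(p := g (n - 1))"
    have n: "n = Suc (n - 1)" using p by simp
    have "lin d g n = lin (d(p := d (n - 1))) ?h (n - 1) + zmul (d p) (g p)" for d
    proof (cases "p = n - 1")
      case True
      have "lin d g n = lin d g (n - 1) + zmul (d p) (g p)"
        unfolding lin_def by (subst n) (simp add: True)
      also have "lin d g (n - 1) = lin (d(p := d (n - 1))) ?h (n - 1)"
        using True by (intro lin_cong) auto
      finally show ?thesis .
    next
      case False
      then have p': "p < n - 1" using p by simp
      let ?R = "\<Sum>j\<in>{..<n - 1} - {p}. zmul (d j) (g j)"
      have "lin d g n = lin d g (n - 1) + zmul (d (n - 1)) (g (n - 1))"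
        unfolding lin_def by (subst n) simp
      moreover have "lin d g (n - 1) = zmul (d p) (g p) + ?R"
        unfolding lin_def using p' by (subst sum.remove[of _ p]) auto
      moreover have "lin (d(p := d (n - 1))) ?h (n - 1) = zmul (d (n - 1)) (g (n - 1)) + ?R"
        unfolding lin_def using p' by (subst sum.remove[of _ p]) (auto intro!: sum.cong)
      ultimately show ?thesis by (simp add: algebra_simps)
    qed
    note eq = this
    have "spans ?h (n - 1)" unfolding spans_def
    proof
      fix x obtain d where "x - lin d g n \<in> torsion" using less.prems(1) by (auto simp: spans_def)
      then have "x - lin d g n + zmul (d p) (g p) \<in> torsion"
        using torsion_zmul[OF gp] is_subgroupD(4)[OF is_subgroup_torsion] by blast
      then have "x - lin (d(p := d (n - 1))) ?h (n - 1) \<in> torsion"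
        by (simp add: eq algebra_simps)
      then show "\<exists>d. x - lin d ?h (n - 1) \<in> torsion" by blast
    qed
    then show ?thesis by blast
  qed
qed

text \<open>Lists of length k correspond to functions vanishing from k on, and unique existence
  transfers along this bijection.\<close>

lemma inf_basis_of_iff:
  "inf_basis_of bs \<longleftrightarrow>
    (\<forall>x. \<exists>!c. c \<in> int_vecs (length bs) \<and> x - lin c ((!) bs) (length bs) \<in> torsion)"
proof -
  let ?k = "length bs"
  let ?f = "\<lambda>c :: nat \<Rightarrow> int. map c [0..<?k]"
  let ?g = "\<lambda>cs j. if j < ?k then cs ! j else (0 :: int)"
  have g: "?g cs \<in> int_vecs ?k" "lin (?g cs) ((!) bs) ?k = lincomb cs bs" for cs
    by (auto simp: int_vecs_def lincomb_eq_lin intro: lin_cong)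
  have f: "length (?f c) = ?k" "lincomb (?f c) bs = lin c ((!) bs) ?k" for c
    by (auto simp: lincomb_eq_lin intro: lin_cong)
  have gf: "?g (?f c) = c" if "c \<in> int_vecs ?k" for c
    using that by (auto simp: int_vecs_def fun_eq_iff)
  have fg: "?f (?g cs) = cs" if "length cs = ?k" for cs
    using that by (intro nth_equalityI) auto
  have "(\<exists>!cs. length cs = ?k \<and> x - lincomb cs bs \<in> torsion) \<longleftrightarrow>
      (\<exists>!c. c \<in> int_vecs ?k \<and> x - lin c ((!) bs) ?k \<in> torsion)" for x
  proof
    assume "\<exists>!cs. length cs = ?k \<and> x - lincomb cs bs \<in> torsion"
    then obtain cs where cs: "length cs = ?k" "x - lincomb cs bs \<in> torsion"
      and u: "\<And>ds. length ds = ?k \<Longrightarrow> x - lincomb ds bs \<in> torsion \<Longrightarrow> ds = cs" by blast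
    show "\<exists>!c. c \<in> int_vecs ?k \<and> x - lin c ((!) bs) ?k \<in> torsion"
    proof (rule ex1I[of _ "?g cs"])
      fix c assume c: "c \<in> int_vecs ?k \<and> x - lin c ((!) bs) ?k \<in> torsion"
      then have fc: "?f c = cs" using f[of c] by (intro u) auto
      have "?g (?f c) = c" using gf[of c] c by blast
      then show "c = ?g cs" unfolding fc by (rule sym)
    qed (use g[of cs] cs in simp)
  next
    assume "\<exists>!c. c \<in> int_vecs ?k \<and> x - lin c ((!) bs) ?k \<in> torsion"
    then obtain c where c: "c \<in> int_vecs ?k" "x - lin c ((!) bs) ?k \<in> torsion"
      and u: "\<And>d. d \<in> int_vecs ?k \<Longrightarrow> x - lin d ((!) bs) ?k \<in> torsion \<Longrightarrow> d = c" by blast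
    show "\<exists>!cs. length cs = ?k \<and> x - lincomb cs bs \<in> torsion"
    proof (rule ex1I[of _ "?f c"])
      fix cs assume cs: "length cs = ?k \<and> x - lincomb cs bs \<in> torsion"
      then have "?g cs = c" using g[of cs] by (intro u) simp_all
      then show "cs = ?f c" using fg[of cs] cs by simp
    qed (use f[of c] c in simp)
  qed
  then show ?thesis by (simp add: inf_basis_of_def)
qed

text \<open>Take the least number of generators modulo torsion. By \<open>spans_reduce\<close> a
  nontrivial relation would permit one fewer, so the coefficients are unique.\<close>

lemma inf_basis_exists:
  assumes "fin_gen_group TYPE('g::ab_group_add)"
  shows "\<exists>bs :: 'g list. inf_basis_of bs"
proof -
  obtain gs :: "'g list" where gs: "\<And>x. \<exists>cs. length cs = length gs \<and> x = lincomb cs gs"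
    using assms by (auto simp: fin_gen_group_def)
  have "spans ((!) gs) (length gs)" unfolding spans_def
  proof
    fix x obtain cs where "x = lincomb cs gs" using gs by blast
    then show "\<exists>c. x - lin c ((!) gs) (length gs) \<in> torsion"
      using is_subgroupD(1)[OF is_subgroup_torsion]
      by (intro exI[of _ "(!) cs"]) (simp add: lincomb_eq_lin)
  qed
  then have ex: "\<exists>n. \<exists>g :: nat \<Rightarrow> 'g. spans g n" by blast
  define n where "n = (LEAST n. \<exists>g :: nat \<Rightarrow> 'g. spans g n)"
  obtain g :: "nat \<Rightarrow> 'g" where g: "spans g n" using LeastI_ex[OF ex] unfolding n_def by blast
  have min: "n \<le> m" if "spans h m" for m and h :: "nat \<Rightarrow> 'g"
    unfolding n_def using that by (intro Least_le) blast
  have indep: "c j = 0" if rel: "lin c g n \<in> torsion" and j: "j < n" for c j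
  proof (rule ccontr)
    assume "c j \<noteq> 0"
    then obtain h :: "nat \<Rightarrow> 'g" where "spans h (n - 1)" using spans_reduce[OF g rel] j by blast
    then show False using min[of h "n - 1"] j by simp
  qed
  let ?bs = "map g [0..<n]"
  have lin: "lin c ((!) ?bs) (length ?bs) = lin c g n" for c by (auto intro: lin_cong)
  have "\<exists>!c. c \<in> int_vecs n \<and> x - lin c g n \<in> torsion" for x
  proof -
    obtain c where c: "x - lin c g n \<in> torsion" using g by (auto simp: spans_def)
    let ?c = "\<lambda>j. if j < n then c j else 0"
    have "lin ?c g n = lin c g n" by (rule lin_cong) auto
    then have "?c \<in> int_vecs n \<and> x - lin ?c g n \<in> torsion" using c by (simp add: int_vecs_def)
    moreover have "d = d'"
      if d: "d \<in> int_vecs n" "x - lin d g n \<in> torsion" "d' \<in> int_vecs n" "x - lin d' g n \<in> torsion"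
      for d d'
    proof
      fix j
      have "(x - lin d' g n) - (x - lin d g n) \<in> torsion"
        using d is_subgroupD(2)[OF is_subgroup_torsion] by blast
      then have "lin (\<lambda>j. d j - d' j) g n \<in> torsion" by (simp add: lin_diff_left)
      from indep[OF this] show "d j = d' j"
        using d(1,3) by (cases "j < n") (auto simp: int_vecs_def)
    qed
    ultimately show ?thesis by blast
  qed
  then have "inf_basis_of ?bs" unfolding inf_basis_of_iff lin by simp
  then show ?thesis by blast
qed

section \<open>Coordinates modulo torsion\<close>

text \<open>The coordinates used in \<open>phi_inf_mat\<close>, as functions instead of lists, so
  that they form a homomorphism into the group \<open>int_vecs\<close>.\<close>

definition inf_coord :: "'g::ab_group_add \<Rightarrow> nat \<Rightarrow> int" where
  "inf_coord x = (THE c. c \<in> int_vecs (rank_inf TYPE('g)) \<and>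
     x - lin c ((!) (inf_basis TYPE('g))) (rank_inf TYPE('g)) \<in> torsion)"

definition inf_mat :: "('g::ab_group_add \<Rightarrow> 'g) \<Rightarrow> int mat" where
  "inf_mat f = (let k = rank_inf TYPE('g) in
     mat k k (\<lambda>(i, j). inf_coord (f (inf_basis TYPE('g) ! j)) i))"

context
  fixes k :: nat and b :: "nat \<Rightarrow> 'g::ab_group_add"
  assumes fg: "fin_gen_group TYPE('g)"
  defines "k \<equiv> rank_inf TYPE('g)" and "b \<equiv> (!) (inf_basis TYPE('g))"
begin

lemma inf_basis: "inf_basis_of (inf_basis TYPE('g))"
  unfolding inf_basis_def using inf_basis_exists[OF fg] by (rule someI_ex)

lemma inf_coord_ex1: "\<exists>!c. c \<in> int_vecs k \<and> x - lin c b k \<in> torsion"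
  using inf_basis unfolding inf_basis_of_iff k_def b_def rank_inf_def by blast

lemma inf_coord_in: "inf_coord (x :: 'g) \<in> int_vecs k"
  and inf_coord_diff: "x - lin (inf_coord x) b k \<in> torsion"
  using theI'[OF inf_coord_ex1[of x]] unfolding inf_coord_def k_def b_def by blast+

lemma inf_coord_eqI: "c \<in> int_vecs k \<Longrightarrow> x - lin c b k \<in> torsion \<Longrightarrow> inf_coord x = c"
  using inf_coord_ex1[of x] inf_coord_in[of x] inf_coord_diff[of x] by blast

lemma additive_inf_coord: "Modules.additive (inf_coord :: 'g \<Rightarrow> _)"
proof
  fix x y :: 'g
  show "inf_coord (x + y) = inf_coord x + inf_coord y"
  proof (rule inf_coord_eqI)
    show "inf_coord x + inf_coord y \<in> int_vecs k"
      using inf_coord_in[of x] inf_coord_in[of y] is_subgroupD(4)[OF is_subgroup_int_vecs] by blast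
    have "lin (inf_coord x + inf_coord y) b k = lin (inf_coord x) b k + lin (inf_coord y) b k"
      using lin_add_left[of "inf_coord x" "inf_coord y"] by (simp add: plus_fun_def)
    then have "x + y - lin (inf_coord x + inf_coord y) b k =
        (x - lin (inf_coord x) b k) + (y - lin (inf_coord y) b k)" by simp
    also have "\<dots> \<in> torsion"
      using inf_coord_diff is_subgroupD(4)[OF is_subgroup_torsion] by blast
    finally show "x + y - lin (inf_coord x + inf_coord y) b k \<in> torsion" .
  qed
qed

lemma inf_coord_eq_0_iff: "inf_coord (x :: 'g) = 0 \<longleftrightarrow> x \<in> torsion"
proof
  assume "inf_coord x = 0"
  moreover have "lin 0 b k = 0" by (simp add: lin_def)
  ultimately show "x \<in> torsion" using inf_coord_diff[of x] by simp
next
  assume "x \<in> torsion"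
  then show "inf_coord x = 0"
    by (intro torsion_int_vecs torsion_hom[OF additive_inf_coord])
qed

lemma inf_coord_surj: "range (inf_coord :: 'g \<Rightarrow> _) = int_vecs k"
proof (intro equalityI subsetI)
  fix c assume "c \<in> int_vecs k"
  then have "inf_coord (lin c b k) = c"
    using is_subgroupD(1)[OF is_subgroup_torsion] by (intro inf_coord_eqI) auto
  then show "c \<in> range (inf_coord :: 'g \<Rightarrow> _)" by (metis rangeI)
qed (use inf_coord_in in auto)

text \<open>Subtracting the free part of an element is a homomorphism t onto the torsion that fixes
  it. Hence the images under t of the generators generate the torsion, and as each has finite order,
  finitely many coefficients suffice.\<close>

lemma finite_torsion: "finite (torsion :: 'g set)"
proof -
  obtain gs :: "'g list" where gs: "\<And>x. \<exists>cs. length cs = length gs \<and> x = lincomb cs gs"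
    using fg by (auto simp: fin_gen_group_def)
  let ?n = "length gs"
  define t where "t = (\<lambda>x. x - lin (inf_coord x) b k)"
  have t: "Modules.additive t"
  proof
    show "t (x + y) = t x + t y" for x y
      using lin_add_left[of "inf_coord x" "inf_coord y" b k]
      by (simp add: t_def additive.add[OF additive_inf_coord] plus_fun_def)
  qed
  have tT: "t x \<in> torsion" for x unfolding t_def by (rule inf_coord_diff)
  have "\<exists>a. a \<noteq> 0 \<and> zmul a (t (gs ! j)) = 0" for j using tT by (auto simp: torsion_iff)
  then obtain a where a: "\<And>j. a j \<noteq> 0" "\<And>j. zmul (a j) (t (gs ! j)) = 0" by metis
  \<comment> \<open>The interval is symmetric because \<open>mod\<close> takes the sign of the
    divisor and a j may be negative.\<close>
  let ?P = "PiE {..<?n} (\<lambda>j. {-\<bar>a j\<bar>..\<bar>a j\<bar>})"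
  have "torsion \<subseteq> (\<lambda>c. lin c (\<lambda>j. t (gs ! j)) ?n) ` ?P"
  proof
    fix x :: 'g assume "x \<in> torsion"
    then have "inf_coord x = 0" by (simp add: inf_coord_eq_0_iff)
    then have "t x = x" by (simp add: t_def lin_def)
    obtain cs where "x = lincomb cs gs" using gs by blast
    then have x: "x = lin ((!) cs) (\<lambda>j. t (gs ! j)) ?n"
      using \<open>t x = x\<close> additive_lin[OF t, of "(!) cs" "(!) gs" ?n] by (simp add: lincomb_eq_lin)
    define c where "c = restrict (\<lambda>j. cs ! j mod a j) {..<?n}"
    have red: "zmul e (t (gs ! j)) = zmul (e mod a j) (t (gs ! j))" for e j
    proof -
      have "zmul e (t (gs ! j)) = zmul (e div a j * a j + e mod a j) (t (gs ! j))" by simp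
      also have "\<dots> = zmul (e mod a j) (t (gs ! j))" by (simp only: zmul_add_left zmul_mult a) simp
      finally show ?thesis .
    qed
    have "x = lin c (\<lambda>j. t (gs ! j)) ?n"
      unfolding x lin_def c_def by (intro sum.cong refl) (subst red, simp)
    moreover have "c \<in> ?P"
    proof -
      have "\<bar>e mod a j\<bar> \<le> \<bar>a j\<bar>" for e j using abs_mod_less[OF a(1)[of j], of e] by simp
      then show ?thesis by (auto simp: c_def abs_le_iff minus_le_iff)
    qed
    ultimately show "x \<in> (\<lambda>c. lin c (\<lambda>j. t (gs ! j)) ?n) ` ?P" by blast
  qed
  then show ?thesis by (rule finite_subset) (intro finite_imageI finite_PiE, auto)
qed

lemma inf_mat_eq: "inf_mat f = mat k k (\<lambda>(i, j). inf_coord (f (b j)) i)"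
  by (simp add: inf_mat_def k_def b_def Let_def)

lemma inf_mat_carrier: "inf_mat (f :: 'g \<Rightarrow> 'g) \<in> carrier_mat k k"
  by (simp add: inf_mat_eq)

text \<open>An element differs from the combination given by its coordinates by torsion; f preserves
  torsion and the coordinates kill it.\<close>

lemma inf_coord_hom:
  fixes f :: "'g \<Rightarrow> 'g"
  assumes f: "Modules.additive f"
  shows "inf_coord (f x) = mat_app k (inf_mat f) (inf_coord x)"
proof
  fix i
  let ?c = "inf_coord x"
  let ?i = "\<lambda>y :: 'g. inf_coord y i"
  have c: "Modules.additive ?i"
    by (rule additive.intro) (simp add: additive.add[OF additive_inf_coord])
  have "inf_coord (f (x - lin ?c b k)) = 0"
    by (simp add: inf_coord_eq_0_iff torsion_hom[OF f inf_coord_diff])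
  then have "?i (f x) = ?i (f (lin ?c b k))"
    by (simp add: additive.diff[OF f] additive.diff[OF additive_inf_coord])
  also have "\<dots> = lin ?c (\<lambda>j. ?i (f (b j))) k"
    by (simp add: additive_lin[OF f] additive_lin[OF c])
  also have "\<dots> = mat_app k (inf_mat f) ?c i"
  proof (cases "i < k")
    case True
    then show ?thesis by (simp add: lin_def mat_app_def inf_mat_eq mult.commute)
  next
    case False
    then have "?i y = 0" for y using inf_coord_in[of y] by (simp add: int_vecs_def)
    then show ?thesis using False by (simp add: lin_def mat_app_def)
  qed
  finally show "inf_coord (f x) i = mat_app k (inf_mat f) (inf_coord x) i" .
qed

text \<open>Passing to an integer matrix makes the lattice index available and gives the
  characteristic polynomial real coefficients.\<close>

lemma phi_inf_mat_eq: "phi_inf_mat (f :: 'g \<Rightarrow> 'g) = map_mat of_int (inf_mat f)"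
proof -
  let ?bs = "inf_basis TYPE('g)"
  have k: "k = length ?bs" by (simp add: k_def rank_inf_def)
  have "(THE cs. length cs = k \<and> x - lincomb cs ?bs \<in> torsion) = map (inf_coord x) [0..<k]" for x
  proof (rule the_equality)
    have "lincomb (map (inf_coord x) [0..<k]) ?bs = lin (inf_coord x) b k"
      unfolding lincomb_eq_lin k b_def by (rule lin_cong) auto
    then show "length (map (inf_coord x) [0..<k]) = k \<and>
        x - lincomb (map (inf_coord x) [0..<k]) ?bs \<in> torsion"
      using inf_coord_diff[of x] by simp
  next
    fix cs assume cs: "length cs = k \<and> x - lincomb cs ?bs \<in> torsion"
    let ?c = "\<lambda>j. if j < k then cs ! j else 0"
    have "lin ?c b k = lincomb cs ?bs"
      unfolding lincomb_eq_lin k[symmetric] b_def by (rule lin_cong) auto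
    then have "inf_coord x = ?c"
      using cs by (intro inf_coord_eqI) (auto simp: int_vecs_def)
    then show "cs = map (inf_coord x) [0..<k]" using cs by (intro nth_equalityI) auto
  qed
  then show ?thesis
    unfolding phi_inf_mat_def Let_def k[symmetric]
    by (intro eq_matI) (auto simp: inf_mat_eq b_def)
qed

end

section \<open>Reidemeister numbers\<close>

text \<open>By commutativity the class of x is the coset of x modulo the image of 1 - psi.\<close>

lemma reid_num_eq_coset_index: "reid_num psi = coset_index UNIV (range (\<lambda>g. g - psi g))"
proof -
  have "reid_rel psi `` {x} = (+) x ` range (\<lambda>g. g - psi g)" for x
    by (auto simp: reid_rel_def image_iff add_diff_eq add.commute[of x])
  moreover have "reid_classes psi = range (\<lambda>x. reid_rel psi `` {x})"
    by (auto simp: reid_classes_def quotient_def)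
  ultimately show ?thesis by (simp add: reid_num_def coset_index_def)
qed

section \<open>Integer matrices acting on coordinate vectors\<close>

lemma mat_app_one: "v \<in> int_vecs k \<Longrightarrow> mat_app k (1\<^sub>m k) v = v"
  by (auto simp: mat_app_def int_vecs_def fun_eq_iff if_distrib[of "\<lambda>x. x * _"] cong: if_cong)

lemma mat_app_mult:
  assumes "A \<in> carrier_mat k k" "B \<in> carrier_mat k k"
  shows "mat_app k (A * B) v = mat_app k A (mat_app k B v)"
proof
  fix i show "mat_app k (A * B) v i = mat_app k A (mat_app k B v) i"
  proof (cases "i < k")
    case True
    have "(\<Sum>j<k. (A * B) $$ (i, j) * v j) = (\<Sum>j<k. (\<Sum>l<k. A $$ (i, l) * B $$ (l, j)) * v j)"
      using True assms by (intro sum.cong) (auto simp: scalar_prod_def atLeast0LessThan)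
    also have "\<dots> = (\<Sum>l<k. A $$ (i, l) * (\<Sum>j<k. B $$ (l, j) * v j))"
      unfolding sum_distrib_left sum_distrib_right by (subst sum.swap) (simp add: mult_ac)
    finally show ?thesis using True by (simp add: mat_app_def)
  qed (simp add: mat_app_def)
qed

lemma mat_app_minus:
  assumes "A \<in> carrier_mat k k" "B \<in> carrier_mat k k"
  shows "mat_app k (A - B) v = mat_app k A v - mat_app k B v"
  using assms by (auto simp: mat_app_def fun_eq_iff algebra_simps sum_subtractf)

lemma mat_app_eq_0_imp:
  assumes M: "M \<in> carrier_mat k k" "det M \<noteq> 0" and v: "v \<in> int_vecs k" "mat_app k M v = 0"
  shows "v = 0"
proof
  fix i
  have "M *\<^sub>v vec k v = 0\<^sub>v k"
  proof (rule eq_vecI)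
    fix i assume "i < dim_vec (0\<^sub>v k :: int vec)"
    then show "vec_index (M *\<^sub>v vec k v) i = vec_index (0\<^sub>v k) i"
      using fun_cong[OF v(2), of i] M by (simp add: mat_app_def scalar_prod_def atLeast0LessThan)
  qed (use M in simp)
  then have "vec k v = 0\<^sub>v k"
    using det_0_iff_vec_prod_zero[OF M(1)] M(2) by (meson vec_carrier)
  then have "vec_index (vec k v) i = 0" if "i < k" using that by simp
  then show "v i = 0 i" using v(1) by (cases "i < k") (auto simp: int_vecs_def)
qed

lemma additive_funpow:
  fixes f :: "'a::ab_group_add \<Rightarrow> 'a"
  shows "Modules.additive f \<Longrightarrow> Modules.additive (f ^^ n)"
  by (induction n) (auto simp: additive_def)

context
  fixes phi :: "'g::ab_group_add \<Rightarrow> 'g"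
  assumes fg: "fin_gen_group TYPE('g)" and phi: "Modules.additive phi"
begin

lemma inf_coord_funpow:
  "inf_coord ((phi ^^ n) x) = mat_app (rank_inf TYPE('g)) (inf_mat phi ^\<^sub>m n) (inf_coord x)"
proof (induction n arbitrary: x)
  case 0
  then show ?case
    using inf_mat_carrier[OF fg, of phi] inf_coord_in[OF fg, of x] by (simp add: mat_app_one)
next
  case (Suc n)
  \<comment> \<open>The innermost phi is split off because a matrix power gains its new factor on
    the right.\<close>
  have "inf_coord ((phi ^^ Suc n) x) = mat_app (rank_inf TYPE('g)) (inf_mat phi ^\<^sub>m n) (inf_coord (phi x))"
    by (simp only: funpow_Suc_right o_apply Suc.IH)
  also have "\<dots> = mat_app (rank_inf TYPE('g)) (inf_mat phi ^\<^sub>m n * inf_mat phi) (inf_coord x)"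
    unfolding inf_coord_hom[OF fg phi]
    by (rule mat_app_mult[symmetric]) (use inf_mat_carrier[OF fg, of phi] in \<open>auto simp: pow_carrier_mat\<close>)
  finally show ?case by simp
qed

text \<open>Finiteness of the Reidemeister classes enters only through \<open>det \<noteq> 0\<close>, which makes
  \<open>1 - phi ^^ n\<close> injective modulo torsion.\<close>

lemma reid_num_funpow:
  assumes fin: "finite (reid_classes (phi ^^ n))"
  shows "reid_num (phi ^^ n) =
    nat \<bar>det (1\<^sub>m (rank_inf TYPE('g)) - inf_mat phi ^\<^sub>m n)\<bar> * card {t \<in> torsion. (phi ^^ n) t = t}"
proof -
  let ?k = "rank_inf TYPE('g)"
  let ?D = "1\<^sub>m ?k - inf_mat phi ^\<^sub>m n"
  let ?h = "\<lambda>g. g - (phi ^^ n) g"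
  have N: "inf_mat phi ^\<^sub>m n \<in> carrier_mat ?k ?k"
    using inf_mat_carrier[OF fg, of phi] by (simp add: pow_carrier_mat)
  have D: "?D \<in> carrier_mat ?k ?k" by (rule minus_carrier_mat[OF N])
  note addn = additive_funpow[OF phi, of n]
  have h: "Modules.additive ?h"
    by (rule additive.intro) (simp add: additive.add[OF addn])
  note c = additive_inf_coord[OF fg]
  have ch: "inf_coord (?h g) = mat_app ?k ?D (inf_coord g)" for g
    using inf_coord_in[OF fg, of g]
    by (simp add: mat_app_minus[OF one_carrier_mat N] mat_app_one inf_coord_funpow additive.diff[OF c])
  have cR: "inf_coord ` range ?h = mat_app ?k ?D ` int_vecs ?k"
    by (simp add: image_image ch inf_coord_surj[OF fg, symmetric])
  have K: "{x \<in> UNIV. inf_coord x = 0} = (torsion :: 'g set)"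
    by (simp add: inf_coord_eq_0_iff[OF fg])
  have "reid_num (phi ^^ n) = coset_index (range (inf_coord :: 'g \<Rightarrow> _)) (inf_coord ` range ?h) *
      coset_index {x \<in> UNIV. inf_coord x = 0} {x \<in> range ?h. inf_coord x = 0}"
    unfolding reid_num_eq_coset_index
    by (rule coset_index_hom[OF is_subgroup_UNIV is_subgroup_image[OF is_subgroup_UNIV h] _ c]) simp
  then have eq: "reid_num (phi ^^ n) =
      nat \<bar>det ?D\<bar> * coset_index torsion {x \<in> range ?h. inf_coord x = 0}"
    unfolding cR K inf_coord_surj[OF fg] coset_index_mat_app[OF D] .
  \<comment> \<open>The set of classes is finite and nonempty, so neither factor in
    \<open>eq\<close> can be 0.\<close>
  have "reid_num (phi ^^ n) \<noteq> 0"
    using fin unfolding reid_num_def by (auto simp: reid_classes_def quotient_def)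
  then have det: "det ?D \<noteq> 0" using eq by auto
  \<comment> \<open>If \<open>?h g\<close> is torsion, the nonsingular D kills the coordinates of g,
    so g is itself torsion.\<close>
  have "{x \<in> range ?h. inf_coord x = 0} = ?h ` torsion"
  proof (intro equalityI subsetI)
    fix x assume "x \<in> {x \<in> range ?h. inf_coord x = 0}"
    then obtain g where g: "x = ?h g" "inf_coord x = 0" by auto
    then have "inf_coord g = 0"
      using mat_app_eq_0_imp[OF D det inf_coord_in[OF fg]] ch[of g] by simp
    then show "x \<in> ?h ` torsion" using g by (simp add: inf_coord_eq_0_iff[OF fg])
  next
    fix x assume "x \<in> ?h ` torsion"
    then obtain g where g: "x = ?h g" "g \<in> torsion" by auto
    then have "x \<in> torsion" using torsion_hom[OF h, of g] by simp
    then show "x \<in> {x \<in> range ?h. inf_coord x = 0}" using g by (simp add: inf_coord_eq_0_iff[OF fg])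
  qed
  moreover have "coset_index torsion (?h ` torsion) = card {t \<in> torsion. ?h t = 0}"
    by (rule coset_index_image_self[OF is_subgroup_torsion finite_torsion[OF fg] h])
      (auto intro: torsion_hom[OF h])
  moreover have "{t \<in> torsion. ?h t = 0} = {t \<in> torsion. (phi ^^ n) t = t}" by auto
  ultimately show ?thesis using eq by simp
qed

lemma A_mat_carrier:
  "A_mat phi \<in> carrier_mat (length (tors_list TYPE('g))) (length (tors_list TYPE('g)))"
  by (simp add: A_mat_def Let_def)

text \<open>The n-th power is the 0-1 matrix of composition with phi^n, and its diagonal marks the
  fixed points.\<close>

lemma mtrace_A_mat_pow:
  "mtrace (A_mat phi ^\<^sub>m n) = of_nat (card {t \<in> torsion. (phi ^^ n) t = t})"
proof -
  let ?ts = "tors_list TYPE('g)"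
  let ?m = "length ?ts"
  have ts: "distinct ?ts" "set ?ts = torsion"
    using someI_ex[OF finite_distinct_list[OF finite_torsion[OF fg]]]
    unfolding tors_list_def by (simp_all add: conj_commute)
  have pow: "(A_mat phi ^\<^sub>m n) $$ (a, b) = (if (phi ^^ n) (?ts ! a) = ?ts ! b then 1 else 0)"
    if "a < ?m" "b < ?m" for a b
    using that
  proof (induction n arbitrary: b)
    case 0
    then show ?case using A_mat_carrier ts(1) by (auto simp: nth_eq_iff_index_eq)
  next
    case (Suc n)
    have "(phi ^^ n) (?ts ! a) \<in> torsion"
      using Suc.prems ts(2) nth_mem by (intro torsion_hom[OF additive_funpow[OF phi]]) blast
    then obtain c where c: "c < ?m" "?ts ! c = (phi ^^ n) (?ts ! a)"
      using ts(2) by (metis in_set_conv_nth)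
    have "(A_mat phi ^\<^sub>m Suc n) $$ (a, b) = (\<Sum>l<?m. (A_mat phi ^\<^sub>m n) $$ (a, l) * A_mat phi $$ (l, b))"
      using Suc.prems A_mat_carrier pow_carrier_mat[OF A_mat_carrier, of n]
      by (auto simp: scalar_prod_def atLeast0LessThan intro!: sum.cong)
    \<comment> \<open>Row a of the n-th power has its only 1 in column c, the position of the image
      of the a-th element.\<close>
    also have "\<dots> = (\<Sum>l<?m. if l = c then (if phi (?ts ! c) = ?ts ! b then 1 else 0) else 0)"
    proof (intro sum.cong refl)
      fix l assume "l \<in> {..<?m}"
      then have l: "l < ?m" by simp
      have "(A_mat phi ^\<^sub>m n) $$ (a, l) = (if ?ts ! c = ?ts ! l then 1 else 0)"
        unfolding c(2) by (rule Suc.IH[OF Suc.prems(1) l])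
      also have "\<dots> = (if l = c then 1 else 0)"
        using nth_eq_iff_index_eq[OF ts(1) c(1) l] by auto
      finally show "(A_mat phi ^\<^sub>m n) $$ (a, l) * A_mat phi $$ (l, b)
          = (if l = c then (if phi (?ts ! c) = ?ts ! b then 1 else 0) else 0)"
        using l Suc.prems(2) by (simp add: A_mat_def Let_def)
    qed
    also have "\<dots> = (if phi (?ts ! c) = ?ts ! b then 1 else 0)" using c by simp
    finally show ?case using c by simp
  qed
  have "mtrace (A_mat phi ^\<^sub>m n) = (\<Sum>a<?m. if (phi ^^ n) (?ts ! a) = ?ts ! a then 1 else 0)"
    using A_mat_carrier pow_carrier_mat[OF A_mat_carrier, of n] pow by (auto simp: mtrace_def)
  also have "\<dots> = (\<Sum>t\<in>torsion. if (phi ^^ n) t = t then 1 else 0)"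
    using bij_betw_nth[OF ts(1) refl ts(2)[symmetric]] by (rule sum.reindex_bij_betw)
  also have "\<dots> = of_nat (card {t \<in> torsion. (phi ^^ n) t = t})"
    using finite_torsion[OF fg] by (simp add: sum.If_cases Int_def)
  finally show ?thesis .
qed

text \<open>Brings the class number into the shape that \<open>fps_exp_log_series_mtrace\<close>
  handles: signed traces of n-th powers of matrices independent of n.\<close>

lemma reid_num_eq_mtrace:
  fixes p r :: nat
  assumes fin: "finite (reid_classes (phi ^^ n))" and n: "n > 0"
  defines "Phi \<equiv> phi_inf_mat phi"
    and "p \<equiv> num_eigs (phi_inf_mat phi) (\<lambda>\<mu>. \<mu> \<in> \<real> \<and> Re \<mu> < -1)"
    and "r \<equiv> num_eigs (phi_inf_mat phi) (\<lambda>\<mu>. \<mu> \<in> \<real> \<and> norm \<mu> > 1)"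
  shows "of_nat (reid_num (phi ^^ n)) = (-1) ^ r * (\<Sum>i\<in>{0..rank_inf TYPE('g)}. (-1) ^ i *
     (((-1) ^ p) ^ n * mtrace (kron (ext_pow_mat i Phi) (A_mat phi) ^\<^sub>m n)))"
proof -
  let ?k = "rank_inf TYPE('g)"
  let ?N = "inf_mat phi"
  have N: "?N \<in> carrier_mat ?k ?k" by (rule inf_mat_carrier[OF fg])
  have Phi: "Phi = map_mat of_int ?N" unfolding Phi_def by (rule phi_inf_mat_eq[OF fg])
  have PhiC: "Phi \<in> carrier_mat ?k ?k" using N by (simp add: Phi)
  have kron: "mtrace (ext_pow_mat i Phi ^\<^sub>m n) * mtrace (A_mat phi ^\<^sub>m n)
      = mtrace (kron (ext_pow_mat i Phi) (A_mat phi) ^\<^sub>m n)" for i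
  proof -
    note E = ext_pow_mat_carrier[OF PhiC, of i]
    obtain m where "n = Suc m" using n by (cases n) auto
    then have "kron (ext_pow_mat i Phi) (A_mat phi) ^\<^sub>m n
        = kron (ext_pow_mat i Phi ^\<^sub>m n) (A_mat phi ^\<^sub>m n)"
      using kron_pow[OF E A_mat_carrier, of m] by simp
    then show ?thesis
      using mtrace_kron[OF pow_carrier_mat[OF E] pow_carrier_mat[OF A_mat_carrier], of n n] by simp
  qed
  have PhiN: "Phi ^\<^sub>m n = map_mat of_int (?N ^\<^sub>m n)"
    unfolding Phi by (rule of_int_hom.mat_hom_pow[OF N, symmetric])
  have "map_mat of_int (1\<^sub>m ?k - ?N ^\<^sub>m n) = 1\<^sub>m ?k - Phi ^\<^sub>m n"
    unfolding PhiN
    by (rule eq_matI) (simp_all add: carrier_matD[OF pow_carrier_mat[OF N]] del: pow_mat_dim)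
  then have "det (1\<^sub>m ?k - Phi ^\<^sub>m n) = of_int (det (1\<^sub>m ?k - ?N ^\<^sub>m n))"
    by (metis of_int_hom.hom_det)
  then have "complex_of_real (norm (det (1\<^sub>m ?k - Phi ^\<^sub>m n))) = of_nat (nat \<bar>det (1\<^sub>m ?k - ?N ^\<^sub>m n)\<bar>)"
    by (simp flip: of_int_abs)
  then have "of_nat (reid_num (phi ^^ n)) =
      complex_of_real (norm (det (1\<^sub>m ?k - Phi ^\<^sub>m n))) * mtrace (A_mat phi ^\<^sub>m n)"
    by (simp only: reid_num_funpow[OF fin] mtrace_A_mat_pow of_nat_mult)
  also have "complex_of_real (norm (det (1\<^sub>m ?k - Phi ^\<^sub>m n))) =
      (-1) ^ (r + p * n) * det (1\<^sub>m ?k - Phi ^\<^sub>m n)"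
    using norm_det_one_minus_pow[OF N, of n] unfolding p_def r_def Phi_def[symmetric] Phi[symmetric] .
  also have "det (1\<^sub>m ?k - Phi ^\<^sub>m n) = (\<Sum>i\<in>{0..?k}. (-1) ^ i * mtrace (ext_pow_mat i Phi ^\<^sub>m n))"
    by (rule det_one_minus_pow_eq_sum_mtrace[OF PhiC n])
  \<comment> \<open>The sign splits into a constant and the n-th power of (-1)^p; the latter joins
    the trace power as the scalar sigma.\<close>
  also have "(-1) ^ (r + p * n) * \<dots> * mtrace (A_mat phi ^\<^sub>m n) =
      (-1) ^ r * (\<Sum>i\<in>{0..?k}. (-1) ^ i * (((-1) ^ p) ^ n *
        (mtrace (ext_pow_mat i Phi ^\<^sub>m n) * mtrace (A_mat phi ^\<^sub>m n))))"
    unfolding power_add power_mult by (simp add: sum_distrib_left sum_distrib_right mult_ac)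
  finally show ?thesis by (simp only: kron)
qed

end

section \<open>The zeta function as an alternating product of determinants\<close>

theorem theorem14:
  fixes phi :: "'g::ab_group_add \<Rightarrow> 'g"
  assumes "fin_gen_group TYPE('g)"
    and "group_endo phi"
    and "\<And>n. n \<ge> 1 \<Longrightarrow> finite (reid_classes (phi ^^ n))"
  defines "k \<equiv> rank_inf TYPE('g)"
    and "Phi \<equiv> phi_inf_mat phi"
    and "A \<equiv> A_mat phi"
    and "p \<equiv> num_eigs (phi_inf_mat phi) (\<lambda>\<mu>. \<mu> \<in> \<real> \<and> Re \<mu> < -1)"
    and "r \<equiv> num_eigs (phi_inf_mat phi) (\<lambda>\<mu>. \<mu> \<in> \<real> \<and> norm \<mu> > 1)"
  shows "(\<exists>P Q :: complex poly. poly Q 0 \<noteq> 0 \<and>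
            reid_zeta phi = fps_of_poly P / fps_of_poly Q)
       \<and> reid_zeta phi =
           fps_pm (even r)
             (\<Prod>i\<in>{0..k}. fps_pm (even (i + 1))
                (fps_of_poly (det_one_minus (kron (ext_pow_mat i Phi) A) ((-1) ^ p))))"
proof -
  have phi: "Modules.additive phi" using assms(2) by (simp add: group_endo_def additive_def)
  let ?B = "\<lambda>i. kron (ext_pow_mat i Phi) A"
  let ?s = "(-1 :: complex) ^ p"
  let ?D = "\<lambda>i. det_one_minus (?B i) ?s"
  let ?L = "\<lambda>i. log_series (\<lambda>n. ?s ^ n * mtrace (?B i ^\<^sub>m n))"
  have PhiC: "Phi \<in> carrier_mat k k"
    unfolding Phi_def k_def phi_inf_mat_eq[OF assms(1)] using inf_mat_carrier[OF assms(1)] by simp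
  let ?m = "\<lambda>i. length (subsets_of_size k i) * length (tors_list TYPE('g))"
  have B: "?B i \<in> carrier_mat (?m i) (?m i)" for i
    unfolding A_def by (rule kron_carrier[OF ext_pow_mat_carrier[OF PhiC] A_mat_carrier[OF assms(1) phi]])
  have D0: "poly (?D i) 0 = 1" for i by (rule det_one_minus_0[OF B])
  \<comment> \<open>exp of \<open>?L i\<close> is already the inverse of the determinant, which
    shifts the parity from i to i + 1. For odd i a double inverse cancels, which needs the nonzero
    constant term.\<close>
  have E: "fps_exp 1 oo (fps_const ((-1) ^ i) * ?L i) = fps_pm (even (i + 1)) (fps_of_poly (?D i))" for i
  proof -
    have "fps_nth (fps_of_poly (?D i)) 0 \<noteq> 0" using D0[of i] by (simp add: poly_0_coeff_0)
    then show ?thesis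
      unfolding fps_exp_compose_sign[OF log_series_0] fps_exp_log_series_mtrace[OF B]
      by (simp add: fps_pm_def)
  qed
  have "reid_zeta phi = fps_exp 1 oo log_series (\<lambda>n. of_nat (reid_num (phi ^^ n)))"
    by (simp add: reid_zeta_def log_series_def)
  also have "log_series (\<lambda>n. of_nat (reid_num (phi ^^ n))) = log_series (\<lambda>n. (-1) ^ r *
      (\<Sum>i\<in>{0..k}. (-1) ^ i * (?s ^ n * mtrace (?B i ^\<^sub>m n))))"
    using reid_num_eq_mtrace[OF assms(1) phi assms(3)]
    unfolding k_def Phi_def A_def p_def r_def by (intro log_series_cong) simp
  also have "\<dots> = fps_const ((-1) ^ r) * (\<Sum>i\<in>{0..k}. fps_const ((-1) ^ i) * ?L i)"
    by (rule fps_ext) (simp add: log_series_def fps_sum_nth sum_divide_distrib sum_distrib_left)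
  also have "fps_exp 1 oo \<dots> = fps_pm (even r) (\<Prod>i\<in>{0..k}. fps_exp 1 oo (fps_const ((-1) ^ i) * ?L i))"
    by (simp add: fps_exp_compose_sign fps_exp_compose_sum fps_sum_nth)
  also have "\<dots> = fps_pm (even r) (\<Prod>i\<in>{0..k}. fps_pm (even (i + 1)) (fps_of_poly (?D i)))"
    by (simp only: E)
  finally have zeta: "reid_zeta phi = \<dots>" .
  have "fps_rational (reid_zeta phi)"
    unfolding zeta using D0 by (intro fps_rational_pm fps_rational_prod fps_rational_of_poly) simp
  then show ?thesis using zeta unfolding fps_rational_def by blast
qed

end
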